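(* Let $R^F$ and $R^B$ be the stationary one-dimensional piecewise deterministic Markov processes, with $R^F_0,R^B_0\sim N(0,1)$, whose (extended) generators are $$L^Ff(x)=f'(x)+x_+\bigl(\mathbb{E}[f(-\tau)]-f(x)\bigr),\qquad L^Bf(x)=f'(x)+x_+\bigl(f(-x)-f(x)\bigr),$$ where $\tau$ is a standard Rayleigh random variable. For $\rho>0$ define $$\sigma_F^2(\rho):=8\int_0^\infty e^{-\rho t}\,\mathbb{E}[R^F_0R^F_t]\,dt,\qquad \sigma_B^2(\rho):=8\int_0^\infty e^{-\rho t}\,\mathbb{E}[R^B_0R^B_t]\,dt,$$ and $$\Omega(\rho):=\rho e^{\rho^2/2}\int_\rho^\infty e^{-t^2/2}\,dt .$$ Then for every $\rho>0$, $$\sigma_F^2(\rho)=\sigma_F^2\left(1-\frac{\left(\rho^2-\rho\sqrt{\frac{\pi}{2}}+\Omega(\rho)\right)^2}{\rho^4\,\Omega(\rho)\,(2-\Omega(\rho))}\right),\qquad \sigma_F^2:=\sqrt{32/\pi},$$ and $$\sigma_B^2(\rho)=\frac{8}{\rho^4}\left(\rho^3-\rho^2\sqrt{\frac{8}{\pi}}+\rho-\sqrt{\frac{8}{\pi}}\,\frac{\left((1+\rho^2)\Omega(\rho)-\rho^2\right)^2}{\Omega(2\rho)}\right).$$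
   Context: Here $x_+=\max(x,0)$, and the standard Rayleigh distribution has density $xe^{-x^2/2}$ on $x>0$. The process $R^F$ moves to the right at unit speed and, when at $x$, jumps with rate $x_+$ to $-\tau$ with $\tau$ a fresh standard Rayleigh variable; $R^B$ moves to the right at unit speed and, when at $x$, jumps with rate $x_+$ to $-x$. Both leave $N(0,1)$ invariant. (They are the high-dimensional limits, without global refreshment, of the radial momentum processes of Forward Event-Chain Monte Carlo and of the Bouncy Particle Sampler for standard Gaussian targets with velocities uniform on the unit sphere; $\rho$ is the global refreshment rate.) *)

theory Defs
  imports "HOL-Probability.Probability"
begin

section \<open>Processes indexed by nonnegative real time\<close>

text \<open>
  A process is a function \<open>X :: real \<Rightarrow> 'a \<Rightarrow> real\<close>; only the times \<open>t \<ge> 0\<close> are relevant. For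
  \<open>t < 0\<close> the natural filtration is the trivial \<open>\<sigma>\<close>-algebra.
\<close>

definition natural_filtration :: "'a measure \<Rightarrow> (real \<Rightarrow> 'a \<Rightarrow> real) \<Rightarrow> real \<Rightarrow> 'a measure" where
  "natural_filtration M X t =
     sigma (space M) {X s -` A \<inter> space M | s A. 0 \<le> s \<and> s \<le> t \<and> A \<in> sets borel}"

definition martingale :: "'a measure \<Rightarrow> (real \<Rightarrow> 'a measure) \<Rightarrow> (real \<Rightarrow> 'a \<Rightarrow> real) \<Rightarrow> bool" where
  "martingale M F N \<longleftrightarrow>
     (\<forall>t\<ge>0. N t \<in> borel_measurable (F t) \<and> integrable M (N t)) \<and>
     (\<forall>s t. 0 \<le> s \<and> s \<le> t \<longrightarrow> (AE \<omega> in M. real_cond_exp M (F s) (N t) \<omega> = N s \<omega>))"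

text \<open>
  Finite-valued localizing times are no restriction: \<open>T n\<close> may be replaced by \<open>min (T n) n\<close>.
\<close>

definition local_martingale ::
  "'a measure \<Rightarrow> (real \<Rightarrow> 'a measure) \<Rightarrow> (real \<Rightarrow> 'a \<Rightarrow> real) \<Rightarrow> bool" where
  "local_martingale M F N \<longleftrightarrow>
     (\<exists>T :: nat \<Rightarrow> 'a \<Rightarrow> real.
        (\<forall>n. stopping_time F (T n) \<and> (\<forall>\<omega>\<in>space M. 0 \<le> T n \<omega>)) \<and>
        (AE \<omega> in M. incseq (\<lambda>n. T n \<omega>) \<and> filterlim (\<lambda>n. T n \<omega>) at_top sequentially) \<and>
        (\<forall>n. martingale M F (\<lambda>t \<omega>. N (min t (T n \<omega>)) \<omega>)))"

definition strictly_stationary :: "'a measure \<Rightarrow> (real \<Rightarrow> 'a \<Rightarrow> real) \<Rightarrow> bool" where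
  "strictly_stationary M X \<longleftrightarrow>
     (\<forall>h\<ge>0. distr M (\<Pi>\<^sub>M t\<in>{0..}. borel) (\<lambda>\<omega>. \<lambda>t\<in>{0..}. X (t + h) \<omega>) =
             distr M (\<Pi>\<^sub>M t\<in>{0..}. borel) (\<lambda>\<omega>. \<lambda>t\<in>{0..}. X t \<omega>))"

text \<open>Time-homogeneous Markov property, with transition kernels \<open>P t\<close>.\<close>

definition markov_process :: "'a measure \<Rightarrow> (real \<Rightarrow> 'a \<Rightarrow> real) \<Rightarrow> bool" where
  "markov_process M X \<longleftrightarrow>
     prob_space M \<and> (\<forall>t\<ge>0. X t \<in> borel_measurable M) \<and>
     (\<exists>P :: real \<Rightarrow> real \<Rightarrow> real measure.
        (\<forall>t\<ge>0. P t \<in> borel \<rightarrow>\<^sub>M prob_algebra borel) \<and>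
        (\<forall>s\<ge>0. \<forall>t\<ge>0. \<forall>A\<in>sets borel. AE \<omega> in M.
           real_cond_exp M (natural_filtration M X s) (\<lambda>\<omega>. indicator A (X (s + t) \<omega>)) \<omega> =
           measure (P t (X s \<omega>)) A))"

section \<open>Piecewise deterministic Markov processes and their extended generators\<close>

text \<open>
  A path follows the flow \<open>\<phi>\<close> except at jump times, finitely many in each bounded time interval.
  A jump at time \<open>s\<close> is already contained in the value \<open>x s\<close>, so paths are right-continuous if
  the flow is.
\<close>

definition piecewise_deterministic ::
  "(real \<Rightarrow> real \<Rightarrow> real) \<Rightarrow> (real \<Rightarrow> real) \<Rightarrow> bool" where
  "piecewise_deterministic \<phi> x \<longleftrightarrow>
     (\<forall>T\<ge>0. \<exists>J. finite J \<and>
        (\<forall>s t. 0 \<le> s \<and> s \<le> t \<and> t \<le> T \<and> {s<..t} \<inter> J = {} \<longrightarrow> x t = \<phi> (t - s) (x s)))"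

definition pdmp ::
  "'a measure \<Rightarrow> (real \<Rightarrow> real \<Rightarrow> real) \<Rightarrow> (real \<Rightarrow> 'a \<Rightarrow> real) \<Rightarrow> bool" where
  "pdmp M \<phi> X \<longleftrightarrow>
     markov_process M X \<and> (AE \<omega> in M. piecewise_deterministic \<phi> (\<lambda>t. X t \<omega>))"

text \<open>
  Davis' extended generator, as a relation between \<open>f\<close> and its image \<open>h\<close>.
\<close>

definition extended_generator ::
  "'a measure \<Rightarrow> (real \<Rightarrow> 'a \<Rightarrow> real) \<Rightarrow> (real \<Rightarrow> real) \<Rightarrow> (real \<Rightarrow> real) \<Rightarrow> bool" where
  "extended_generator M X f h \<longleftrightarrow>
     f \<in> borel_measurable borel \<and> h \<in> borel_measurable borel \<and>
     (AE \<omega> in M. \<forall>t\<ge>0. set_integrable lborel {0..t} (\<lambda>s. h (X s \<omega>))) \<and>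
     local_martingale M (natural_filtration M X)
       (\<lambda>t \<omega>. f (X t \<omega>) - f (X 0 \<omega>) - (LBINT s:{0..t}. h (X s \<omega>)))"

text \<open>
  The process has extended generator \<open>L\<close>. The formula for \<open>L\<close> is only required on bounded
  \<open>C\<^sup>1\<close> functions, which lie in the domain of the extended generator of every nonexplosive
  process of the kind considered here, and on which every term of \<open>L f\<close> is defined.
\<close>

definition has_extended_generator ::
  "'a measure \<Rightarrow> (real \<Rightarrow> 'a \<Rightarrow> real) \<Rightarrow> ((real \<Rightarrow> real) \<Rightarrow> real \<Rightarrow> real) \<Rightarrow> bool" where
  "has_extended_generator M X L \<longleftrightarrow>
     (\<forall>f. f C1_differentiable_on UNIV \<and> bounded (range f) \<longrightarrow> extended_generator M X f (L f))"

section \<open>The two radial momentum processes\<close>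

definition rayleigh :: "real measure" where
  "rayleigh = density lborel (\<lambda>x. ennreal (if 0 < x then x * exp (- x\<^sup>2 / 2) else 0))"

definition gen_F :: "(real \<Rightarrow> real) \<Rightarrow> real \<Rightarrow> real" where
  "gen_F f x = deriv f x + max x 0 * ((\<integral>y. f (- y) \<partial>rayleigh) - f x)"

definition gen_B :: "(real \<Rightarrow> real) \<Rightarrow> real \<Rightarrow> real" where
  "gen_B f x = deriv f x + max x 0 * (f (- x) - f x)"

definition stationary_pdmp ::
  "((real \<Rightarrow> real) \<Rightarrow> real \<Rightarrow> real) \<Rightarrow> 'a measure \<Rightarrow> (real \<Rightarrow> 'a \<Rightarrow> real) \<Rightarrow> bool" where
  "stationary_pdmp L M R \<longleftrightarrow>
     pdmp M (\<lambda>t x. x + t) R \<and>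
     has_extended_generator M R L \<and>
     strictly_stationary M R \<and>
     distributed M lborel (R 0) std_normal_density"

definition sigma_sq :: "'a measure \<Rightarrow> (real \<Rightarrow> 'a \<Rightarrow> real) \<Rightarrow> real \<Rightarrow> real" where
  "sigma_sq M R \<rho> = 8 * (LBINT t:{0..}. exp (- \<rho> * t) * (\<integral>\<omega>. R 0 \<omega> * R t \<omega> \<partial>M))"

definition Omega :: "real \<Rightarrow> real" where
  "Omega \<rho> = \<rho> * exp (\<rho>\<^sup>2 / 2) * (LBINT t:{\<rho>..}. exp (- t\<^sup>2 / 2))"

end

theory Submission
  imports Defs "HOL-Real_Asymp.Real_Asymp"
begin

text \<open>
  With \<open>R\<close> stationary and \<open>L\<close> its generator, the Laplace transform of the correlation function
  is \<open>E[R\<^sub>0 g(R\<^sub>0)]\<close>, where \<open>g\<close> solves the resolvent equation \<open>\<rho> g - L g = x\<close>. On the negative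
  half line there are no jumps and \<open>g\<close> is affine plus \<open>K e\<^bsup>\<rho>x\<^esup>\<close>; on the positive half line the
  equation is a linear first-order ODE whose polynomially bounded solution is explicit in terms of
  the Mills ratio \<open>m(a) = \<integral>\<^sub>0\<^sup>\<infinity> exp (- a u - u\<^sup>2 / 2) du\<close>, which satisfies \<open>m' = a m - 1\<close> and
  \<open>\<Omega>(a) = a m(a)\<close>. Matching the branches at 0 fixes \<open>K\<close>, and the remaining Gaussian integrals
  have explicit antiderivatives.

  The probabilistic input is that the local martingale of the extended generator, multiplied by
  \<open>R\<^sub>0\<close> and stopped, has expectation 0; stationarity gives the domination that removes the
  localization. Since \<open>g\<close> is unbounded, it is approximated by \<open>g / (1 + \<epsilon> x\<^sup>2)\<close>.
\<close>

text \<open>For \<open>x > 0\<close> the resolvent equation reads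
  \<open>g' = (\<rho> + x) g - x (1 + J g)\<close>, where \<open>J g\<close> is the mean of
  \<open>g\<close> after a jump. The homogeneous solution \<open>exp (\<rho> x + x^2 / 2)\<close>
  outgrows every polynomial, so the admissible solution is the integral of
  \<open>(x + u) (1 + J g (x + u)) exp (- (\<rho> + x) u - u^2 / 2)\<close> over
  \<open>u > 0\<close>; this is where \<open>mills (\<rho> + x)\<close> comes from. The forward jump
  forgets the position, so \<open>J g\<close> is one unknown constant. The bouncy jump gives
  \<open>J g x = g (- x)\<close>, known up to \<open>K\<close> from the negative half line; its term
  \<open>K exp (- \<rho> x)\<close> adds a second \<rho> to the exponent, hence
  \<open>Omega (2 \<rho>)\<close>. The generator is given on bounded \<open>C1\<close> functions
  only, and the estimates rest on the laws at fixed times alone. Since \<open>g\<close> grows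
  linearly and the jump rate adds a power of \<open>x\<close>, everything is dominated with
  quadratic growth and fourth Gaussian moments.\<close>

section \<open>Dynkin's formula for stationary correlations\<close>

text \<open>Dominates the products \<open>x h(y)\<close> with \<open>h\<close> of quadratic growth, and splits into functions of
  \<open>x\<close> and \<open>y\<close> alone, so that only the marginals enter.\<close>

definition gauss_weight :: "real \<Rightarrow> real" where
  "gauss_weight x = x\<^sup>2 + (1 + x\<^sup>2)\<^sup>2"

definition gauss_const :: real where
  "gauss_const = (\<integral>x. std_normal_density x * gauss_weight x \<partial>lborel)"

lemma integrable_gauss_weight: "integrable lborel (\<lambda>x. std_normal_density x * gauss_weight x)"
proof -
  have m: "integrable lborel (\<lambda>x. std_normal_density x * x ^ k)" for k
    using integrable_normal_moment[of 1 0 k] by simp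
  have "integrable lborel (\<lambda>x. std_normal_density x * x ^ 0 + 3 * (std_normal_density x * x ^ 2)
      + std_normal_density x * x ^ 4)"
    by (intro Bochner_Integration.integrable_add integrable_mult_right m)
  also have "(\<lambda>x. std_normal_density x * x ^ 0 + 3 * (std_normal_density x * x ^ 2)
      + std_normal_density x * x ^ 4) = (\<lambda>x. std_normal_density x * gauss_weight x)"
    by (auto simp: gauss_weight_def fun_eq_iff algebra_simps power2_eq_square power4_eq_xxxx)
  finally show ?thesis .
qed

lemma gauss_weight_borel [measurable]: "gauss_weight \<in> borel_measurable borel"
  unfolding gauss_weight_def by measurable

text \<open>The inequality of arithmetic and geometric means decouples the two variables. The
  assumption forces \<open>C\<close> to be nonnegative.\<close>

lemma mult_le_gauss_weight:
  assumes "\<bar>h\<bar> \<le> C * (1 + y\<^sup>2)"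
  shows "\<bar>x * h\<bar> \<le> C * (gauss_weight x + gauss_weight y) / 2"
proof -
  have C: "0 \<le> C" using assms abs_ge_zero[of h]
    by (smt (verit) mult_neg_pos zero_le_power2 zero_less_one)
  have "\<bar>x * h\<bar> \<le> \<bar>x\<bar> * (C * (1 + y\<^sup>2))"
    unfolding abs_mult using assms by (intro mult_left_mono) auto
  also have "\<dots> = C * (\<bar>x\<bar> * (1 + y\<^sup>2))" by simp
  also have "\<dots> \<le> C * ((x\<^sup>2 + (1 + y\<^sup>2)\<^sup>2) / 2)"
  proof (intro mult_left_mono C)
    have "0 \<le> (\<bar>x\<bar> - (1 + y\<^sup>2))\<^sup>2" by simp
    then show "\<bar>x\<bar> * (1 + y\<^sup>2) \<le> (x\<^sup>2 + (1 + y\<^sup>2)\<^sup>2) / 2"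
      unfolding power2_diff power2_abs by simp
  qed
  also have "\<dots> \<le> C * ((gauss_weight x + gauss_weight y) / 2)"
    unfolding gauss_weight_def by (intro mult_left_mono C) auto
  finally show ?thesis by simp
qed

text \<open>\<open>X\<close> itself need not be jointly measurable in time and state, which Fubini's theorem requires;
  \<open>Y\<close> is an indistinguishable version that is.\<close>

locale normal_process = prob_space M for M :: "'a measure" +
  fixes X Y :: "real \<Rightarrow> 'a \<Rightarrow> real"
  assumes X_normal: "\<And>t. 0 \<le> t \<Longrightarrow> distributed M lborel (X t) std_normal_density"
    and Y_measurable: "case_prod Y \<in> borel_measurable (borel \<Otimes>\<^sub>M M)"
    and Y_eq: "AE \<omega> in M. \<forall>t\<ge>0. Y t \<omega> = X t \<omega>"
begin

lemma X_borel: "0 \<le> t \<Longrightarrow> X t \<in> borel_measurable M"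
  using distributed_measurable[OF X_normal] by simp

lemma X0_borel [measurable]: "X 0 \<in> borel_measurable M"
  by (rule X_borel) simp

lemma Y_borel [measurable (raw)]:
  assumes [measurable]: "f \<in> borel_measurable N" "g \<in> measurable N M"
  shows "(\<lambda>x. Y (f x) (g x)) \<in> borel_measurable N"
proof -
  have "(\<lambda>x. case_prod Y (f x, g x)) \<in> borel_measurable N"
    by (rule measurable_compose[OF _ Y_measurable]) measurable
  then show ?thesis by simp
qed

lemma gauss_weight_X:
  assumes "0 \<le> t"
  shows "integrable M (\<lambda>\<omega>. gauss_weight (X t \<omega>))"
    and "(\<integral>\<omega>. gauss_weight (X t \<omega>) \<partial>M) = gauss_const"
proof -
  show "integrable M (\<lambda>\<omega>. gauss_weight (X t \<omega>))"
    using distributed_integrable[OF X_normal[OF assms], of gauss_weight] integrable_gauss_weight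
    by simp
  show "(\<integral>\<omega>. gauss_weight (X t \<omega>) \<partial>M) = gauss_const"
    unfolding gauss_const_def
    using distributed_integral[OF X_normal[OF assms], of gauss_weight] by simp
qed

text \<open>All \<open>X t\<close> have the same law, so the bounds do not depend on
  \<open>t\<close>. This uniformity later makes the Laplace integrals converge.\<close>

lemma correlation_bound:
  assumes t: "0 \<le> t" and [measurable]: "h \<in> borel_measurable borel"
    and h: "\<And>x. \<bar>h x\<bar> \<le> C * (1 + x\<^sup>2)"
  shows "integrable M (\<lambda>\<omega>. X 0 \<omega> * h (X t \<omega>))"
    and "(\<integral>\<omega>. \<bar>X 0 \<omega> * h (X t \<omega>)\<bar> \<partial>M) \<le> C * gauss_const"
    and "\<bar>\<integral>\<omega>. X 0 \<omega> * h (X t \<omega>) \<partial>M\<bar> \<le> C * gauss_const"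
proof -
  note [measurable] = X_borel[OF t]
  let ?D = "\<lambda>\<omega>. C * (gauss_weight (X 0 \<omega>) + gauss_weight (X t \<omega>)) / 2"
  have D: "integrable M ?D"
    by (intro integrable_divide integrable_mult_right Bochner_Integration.integrable_add
        gauss_weight_X t) simp
  have bd: "\<bar>X 0 \<omega> * h (X t \<omega>)\<bar> \<le> ?D \<omega>" for \<omega>
    by (rule mult_le_gauss_weight[OF h])
  show I: "integrable M (\<lambda>\<omega>. X 0 \<omega> * h (X t \<omega>))"
    by (rule Bochner_Integration.integrable_bound[OF D], measurable)
       (rule AE_I2, unfold real_norm_def, rule order_trans[OF bd abs_ge_self])
  have "(\<integral>\<omega>. \<bar>X 0 \<omega> * h (X t \<omega>)\<bar> \<partial>M) \<le> (\<integral>\<omega>. ?D \<omega> \<partial>M)"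
    by (intro integral_mono integrable_abs I D bd)
  also have "\<dots> = C * gauss_const"
    using gauss_weight_X[OF t] gauss_weight_X[of 0] by simp
  finally show J: "(\<integral>\<omega>. \<bar>X 0 \<omega> * h (X t \<omega>)\<bar> \<partial>M) \<le> C * gauss_const" .
  show "\<bar>\<integral>\<omega>. X 0 \<omega> * h (X t \<omega>) \<partial>M\<bar> \<le> C * gauss_const"
    by (rule order_trans[OF integral_abs_bound J])
qed

lemma AE_Y_eq: "0 \<le> t \<Longrightarrow> AE \<omega> in M. Y t \<omega> = X t \<omega>"
  using Y_eq by eventually_elim simp

text \<open>Passing to \<open>Y\<close> shows that a correlation is measurable as a function of
  time.\<close>

lemma correlation_Y:
  assumes t: "0 \<le> t" and [measurable]: "h \<in> borel_measurable borel"
  shows "(\<integral>\<omega>. X 0 \<omega> * h (Y t \<omega>) \<partial>M) = (\<integral>\<omega>. X 0 \<omega> * h (X t \<omega>) \<partial>M)"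
proof -
  note [measurable] = X_borel[OF t]
  show ?thesis using AE_Y_eq[OF t] by (intro integral_cong_AE) (measurable, auto)
qed

text \<open>The bound on each time slice is uniform, so the slices over \<open>[0, t]\<close> sum to
  a finite total and Fubini applies.\<close>

lemma integrable_path_integral:
  assumes t: "0 \<le> t" and [measurable]: "h \<in> borel_measurable borel"
    and h: "\<And>x. \<bar>h x\<bar> \<le> C * (1 + x\<^sup>2)"
  shows "integrable (lborel \<Otimes>\<^sub>M M) (\<lambda>(s, \<omega>). indicator {0..t} s * (X 0 \<omega> * h (Y s \<omega>)))"
proof -
  interpret pair_sigma_finite lborel M ..
  have I: "integrable M (\<lambda>\<omega>. X 0 \<omega> * h (Y s \<omega>))" if "0 \<le> s" for s
  proof -
    note [measurable] = X_borel[OF that]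
    show ?thesis
      using AE_Y_eq[OF that] correlation_bound(1)[OF that _ h]
      by (subst integrable_cong_AE[where g="\<lambda>\<omega>. X 0 \<omega> * h (X s \<omega>)"]) (measurable, auto)
  qed
  show ?thesis
  proof (rule Fubini_integrable)
    show "(\<lambda>(s, \<omega>). indicator {0..t} s * (X 0 \<omega> * h (Y s \<omega>))) \<in> borel_measurable (lborel \<Otimes>\<^sub>M M)"
      by measurable
    show "AE s in lborel. integrable M (\<lambda>\<omega>. case (s, \<omega>) of (s, \<omega>) \<Rightarrow>
        indicator {0..t} s * (X 0 \<omega> * h (Y s \<omega>)))"
      by (intro AE_I2) (auto simp: I split: split_indicator)
have bd: "(\<integral>\<omega>. norm (indicator {0..t} s * (X 0 \<omega> * h (Y s \<omega>))) \<partial>M)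
        \<le> indicator {0..t} s * (C * gauss_const)" for s
    proof (cases "s \<in> {0..t}")
      case True
      then have s: "0 \<le> s" by simp
      note [measurable] = X_borel[OF s]
      have "(\<integral>\<omega>. \<bar>X 0 \<omega> * h (Y s \<omega>)\<bar> \<partial>M) = (\<integral>\<omega>. \<bar>X 0 \<omega> * h (X s \<omega>)\<bar> \<partial>M)"
        using AE_Y_eq[OF s] by (intro integral_cong_AE) (measurable, auto)
      then show ?thesis using correlation_bound(2)[OF s _ h] True by simp
    qed simp
    show "integrable lborel (\<lambda>s. \<integral>\<omega>. norm (case (s, \<omega>) of (s, \<omega>) \<Rightarrow>
        indicator {0..t} s * (X 0 \<omega> * h (Y s \<omega>))) \<partial>M)"
    proof (rule Bochner_Integration.integrable_bound)
      show "integrable lborel (\<lambda>s. indicator {0..t} s * (C * gauss_const))"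
        by (intro integrable_mult_left, subst integrable_indicator_iff) (use t in simp)
      show "AE s in lborel. norm (\<integral>\<omega>. norm (case (s, \<omega>) of (s, \<omega>) \<Rightarrow>
          indicator {0..t} s * (X 0 \<omega> * h (Y s \<omega>))) \<partial>M)
          \<le> norm (indicator {0..t} s * (C * gauss_const))"
      proof (rule AE_I2)
        fix s :: real
        have "0 \<le> (\<integral>\<omega>. norm (indicator {0..t} s * (X 0 \<omega> * h (Y s \<omega>))) \<partial>M)" by simp
        then show "norm (\<integral>\<omega>. norm (case (s, \<omega>) of (s, \<omega>) \<Rightarrow>
            indicator {0..t} s * (X 0 \<omega> * h (Y s \<omega>))) \<partial>M)
            \<le> norm (indicator {0..t} s * (C * gauss_const))"
          using bd[of s] by (simp only: real_norm_def prod.case)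
      qed
    qed measurable
  qed
qed

lemma subalgebra_natural_filtration: "subalgebra M (natural_filtration M X t)"
proof -
  have *: "{X s -` A \<inter> space M |s A. 0 \<le> s \<and> s \<le> t \<and> A \<in> sets borel} \<subseteq> sets M"
    using X_borel by (auto intro: measurable_sets)
  then have "{X s -` A \<inter> space M |s A. 0 \<le> s \<and> s \<le> t \<and> A \<in> sets borel} \<subseteq> Pow (space M)"
    using sets.sets_into_space by blast
  then show ?thesis
    unfolding subalgebra_def natural_filtration_def
    using * sets.sigma_sets_subset[OF *] by (simp add: space_measure_of_conv)
qed

lemma X0_natural_filtration: "X 0 \<in> borel_measurable (natural_filtration M X 0)"
proof (rule measurableI)
  fix A :: "real set" assume A: "A \<in> sets borel"
  have sp: "space (natural_filtration M X 0) = space M"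
    unfolding natural_filtration_def by (simp add: space_measure_of_conv)
  have "{X s -` A \<inter> space M |s A. 0 \<le> s \<and> s \<le> 0 \<and> A \<in> sets borel} \<subseteq> Pow (space M)"
    by auto
  then show "X 0 -` A \<inter> space (natural_filtration M X 0) \<in> sets (natural_filtration M X 0)"
    unfolding sp unfolding natural_filtration_def using A
    by (auto simp: sets_measure_of intro!: sigma_sets.Basic exI[of _ "0::real"] exI[of _ A])
qed auto

text \<open>The law of \<open>X\<close> at a stopping time is unknown, so the domination must avoid
  it. Boundedness of \<open>f\<close> controls the endpoint terms by \<open>2 * B\<close>, and the
  integral up to the random time is at most the integral of the absolute value over all of
  \<open>[0, t]\<close>, whose expectation involves only fixed times.\<close>

lemma dynkin:
  assumes gen: "extended_generator M X f h"
    and f: "\<And>x. \<bar>f x\<bar> \<le> B" and h: "\<And>x. \<bar>h x\<bar> \<le> C * (1 + x\<^sup>2)" and t: "0 \<le> t"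
  shows "(\<integral>\<omega>. X 0 \<omega> * f (X t \<omega>) \<partial>M) =
    (\<integral>\<omega>. X 0 \<omega> * f (X 0 \<omega>) \<partial>M) + (LBINT s:{0..t}. \<integral>\<omega>. X 0 \<omega> * h (X s \<omega>) \<partial>M)"
proof -
  interpret pair_sigma_finite lborel M ..
  interpret finite_measure_subalgebra M "natural_filtration M X 0"
    by unfold_locales (rule subalgebra_natural_filtration)
  note [measurable] = X_borel[OF t]
  define N where "N = (\<lambda>t \<omega>. f (X t \<omega>) - f (X 0 \<omega>) - (LBINT s:{0..t}. h (X s \<omega>)))"
  from gen have [measurable]: "f \<in> borel_measurable borel" "h \<in> borel_measurable borel"
    and hint: "AE \<omega> in M. \<forall>t\<ge>0. set_integrable lborel {0..t} (\<lambda>s. h (X s \<omega>))"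
    and loc: "local_martingale M (natural_filtration M X) N"
    unfolding extended_generator_def N_def by auto
  from loc obtain T where T0: "\<And>n \<omega>. \<omega> \<in> space M \<Longrightarrow> 0 \<le> T n \<omega>"
    and Tinf: "AE \<omega> in M. incseq (\<lambda>n. T n \<omega>) \<and> filterlim (\<lambda>n. T n \<omega>) at_top sequentially"
    and mart: "\<And>n. martingale M (natural_filtration M X) (\<lambda>t \<omega>. N (min t (T n \<omega>)) \<omega>)"
    unfolding local_martingale_def by blast
  have B: "0 \<le> B" using f[of 0] by linarith
  define P where "P = (\<lambda>(s, \<omega>). indicator {0..t} s * (X 0 \<omega> * h (Y s \<omega>)))"
  have P: "integrable (lborel \<Otimes>\<^sub>M M) P"
    unfolding P_def by (rule integrable_path_integral[OF t _ h]) simp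
  define H where "H \<omega> = (\<integral>s. P (s, \<omega>) \<partial>lborel)" for \<omega>
  define A where "A \<omega> = (\<integral>s. norm (P (s, \<omega>)) \<partial>lborel)" for \<omega>
  have H: "integrable M H" unfolding H_def using P
    by (intro integrable_snd) simp
  have A: "integrable M A" unfolding A_def using integrable_norm[OF P]
    by (intro integrable_snd) (simp add: case_prod_unfold)
  have AEP: "AE \<omega> in M. integrable lborel (\<lambda>s. P (s, \<omega>))"
    using AE_integrable_snd[of "\<lambda>s \<omega>. P (s, \<omega>)"] P by simp
  have X0: "integrable M (\<lambda>\<omega>. \<bar>X 0 \<omega>\<bar>)"
    using integrable_abs[OF correlation_bound(1)[of 0 "\<lambda>_. 1" 1]] by simp
  have Xf: "integrable M (\<lambda>\<omega>. X 0 \<omega> * f (X u \<omega>))" if "0 \<le> u" for u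
    by (rule correlation_bound(1)[OF that, of f B])
       (auto intro: order_trans[OF f] mult_left_mono B simp: algebra_simps B)
  define W where "W \<omega> = \<bar>X 0 \<omega>\<bar> * (2 * B) + A \<omega>" for \<omega>
  have W: "integrable M W" unfolding W_def
    by (intro Bochner_Integration.integrable_add integrable_mult_left X0 A)
  \<comment> \<open>One null set has to serve all \<open>u\<close>, because the random time
    \<open>min t (T n \<omega>)\<close> is substituted for \<open>u\<close> afterwards.\<close>
  have N_bound: "AE \<omega> in M. \<forall>u. 0 \<le> u \<longrightarrow> u \<le> t \<longrightarrow> \<bar>X 0 \<omega> * N u \<omega>\<bar> \<le> W \<omega>"
    using hint Y_eq
  proof eventually_elim
    case (elim \<omega>)
    show ?case
    proof (intro allI impI)
      fix u assume u: "0 \<le> u" "u \<le> t"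
      have it: "integrable lborel (\<lambda>s. indicator {0..t} s * h (X s \<omega>))"
        using elim(1) t unfolding set_integrable_def by simp
      have iu: "integrable lborel (\<lambda>s. indicator {0..u} s * h (X s \<omega>))"
        using elim(1) u unfolding set_integrable_def by simp
      have "\<bar>LBINT s:{0..u}. h (X s \<omega>)\<bar> \<le> (\<integral>s. \<bar>indicator {0..u} s * h (X s \<omega>)\<bar> \<partial>lborel)"
        unfolding set_lebesgue_integral_def using integral_abs_bound by simp
      also have "\<dots> \<le> (\<integral>s. \<bar>indicator {0..t} s * h (X s \<omega>)\<bar> \<partial>lborel)"
        using u by (intro integral_mono integrable_abs it iu) (auto split: split_indicator)
      finally have "\<bar>X 0 \<omega>\<bar> * \<bar>LBINT s:{0..u}. h (X s \<omega>)\<bar> \<le>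
          \<bar>X 0 \<omega>\<bar> * (\<integral>s. \<bar>indicator {0..t} s * h (X s \<omega>)\<bar> \<partial>lborel)"
        by (intro mult_left_mono) auto
      also have "\<dots> = (\<integral>s. \<bar>X 0 \<omega>\<bar> * \<bar>indicator {0..t} s * h (X s \<omega>)\<bar> \<partial>lborel)"
        by simp
      also have "\<dots> = A \<omega>"
        unfolding A_def P_def
        by (intro Bochner_Integration.integral_cong)
           (auto simp: abs_mult elim(2) split: split_indicator)
      finally have 1: "\<bar>X 0 \<omega>\<bar> * \<bar>LBINT s:{0..u}. h (X s \<omega>)\<bar> \<le> A \<omega>" .
      have "\<bar>N u \<omega>\<bar> \<le> 2 * B + \<bar>LBINT s:{0..u}. h (X s \<omega>)\<bar>"
        unfolding N_def using f[of "X u \<omega>"] f[of "X 0 \<omega>"] by linarith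
      then have "\<bar>X 0 \<omega>\<bar> * \<bar>N u \<omega>\<bar> \<le> \<bar>X 0 \<omega>\<bar> * (2 * B + \<bar>LBINT s:{0..u}. h (X s \<omega>)\<bar>)"
        by (intro mult_left_mono) auto
      then show "\<bar>X 0 \<omega> * N u \<omega>\<bar> \<le> W \<omega>"
        unfolding W_def abs_mult using 1 by (simp add: distrib_left)
    qed
  qed
  have bd: "AE \<omega> in M. norm (X 0 \<omega> * N (min t (T n \<omega>)) \<omega>) \<le> W \<omega>" for n
    using N_bound AE_space by eventually_elim (use t T0 in auto)
  have meas: "(\<lambda>\<omega>. N (min t (T n \<omega>)) \<omega>) \<in> borel_measurable M" for n
    using mart[of n] t unfolding martingale_def by (auto dest: borel_measurable_integrable)
  have zero: "(\<integral>\<omega>. X 0 \<omega> * N (min t (T n \<omega>)) \<omega> \<partial>M) = 0" for n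
  proof -
    note [measurable] = meas[of n]
    have "integrable M (\<lambda>\<omega>. X 0 \<omega> * N (min t (T n \<omega>)) \<omega>)"
      by (rule Bochner_Integration.integrable_bound[OF W]) (measurable, use bd[of n] in auto)
    \<comment> \<open>\<open>X 0\<close> is measurable at time 0, so the stopped process may be
      replaced by its conditional expectation given time 0, which is its initial value 0.\<close>
    from real_cond_exp_intg(2)[OF this X0_natural_filtration meas[of n]]
    have "(\<integral>\<omega>. X 0 \<omega> * N (min t (T n \<omega>)) \<omega> \<partial>M) =
       (\<integral>\<omega>. X 0 \<omega> * real_cond_exp M (natural_filtration M X 0) (\<lambda>\<omega>. N (min t (T n \<omega>)) \<omega>) \<omega> \<partial>M)"
      by simp
    also have "\<dots> = (\<integral>\<omega>. 0 \<partial>M)"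
    proof (rule integral_cong_AE)
      have "AE \<omega> in M. real_cond_exp M (natural_filtration M X 0) (\<lambda>\<omega>. N (min t (T n \<omega>)) \<omega>) \<omega>
          = N (min 0 (T n \<omega>)) \<omega>"
        using mart[of n] t unfolding martingale_def by blast
      then show "AE \<omega> in M. X 0 \<omega> * real_cond_exp M (natural_filtration M X 0)
          (\<lambda>\<omega>. N (min t (T n \<omega>)) \<omega>) \<omega> = 0"
        using AE_space
      proof eventually_elim
        case (elim \<omega>)
        have "(LBINT s:{0..0::real}. h (X s \<omega>)) = 0"
          unfolding set_lebesgue_integral_def
          by (rule integral_eq_zero_AE) (use AE_lborel_singleton[of 0] in \<open>auto elim!: eventually_mono\<close>)
        with elim T0[of \<omega> n] show ?case by (simp add: N_def min_def)
      qed
    qed measurable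
    finally show ?thesis by simp
  qed
  define G where "G \<omega> = X 0 \<omega> * f (X t \<omega>) - X 0 \<omega> * f (X 0 \<omega>) - H \<omega>" for \<omega>
  have "(\<lambda>n. \<integral>\<omega>. X 0 \<omega> * N (min t (T n \<omega>)) \<omega> \<partial>M) \<longlonglongrightarrow> (\<integral>\<omega>. G \<omega> \<partial>M)"
  proof (rule integral_dominated_convergence[OF _ _ W _ bd])
    show "G \<in> borel_measurable M" unfolding G_def using borel_measurable_integrable[OF H] by measurable
    show "(\<lambda>\<omega>. X 0 \<omega> * N (min t (T n \<omega>)) \<omega>) \<in> borel_measurable M" for n
      using meas[of n] by measurable
    show "AE \<omega> in M. (\<lambda>n. X 0 \<omega> * N (min t (T n \<omega>)) \<omega>) \<longlonglongrightarrow> G \<omega>"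
      using Tinf Y_eq
    proof eventually_elim
      case (elim \<omega>)
      have "\<forall>\<^sub>F n in sequentially. t \<le> T n \<omega>"
        using elim(1) by (simp add: filterlim_at_top)
      then have ev: "\<forall>\<^sub>F n in sequentially. X 0 \<omega> * N (min t (T n \<omega>)) \<omega> = X 0 \<omega> * N t \<omega>"
        by eventually_elim (simp add: min_def)
      have "H \<omega> = X 0 \<omega> * (LBINT s:{0..t}. h (X s \<omega>))"
        unfolding H_def P_def set_lebesgue_integral_def
        by (subst integral_mult_right_zero[symmetric], intro Bochner_Integration.integral_cong)
           (auto simp: elim(2) split: split_indicator)
      then have "X 0 \<omega> * N t \<omega> = G \<omega>"
        unfolding N_def G_def by (simp add: algebra_simps)
      then show ?case using ev by (intro tendsto_eventually) simp
    qed
  qed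
  then have "(\<integral>\<omega>. G \<omega> \<partial>M) = 0"
    unfolding zero using LIMSEQ_unique tendsto_const by blast
  then have "(\<integral>\<omega>. X 0 \<omega> * f (X t \<omega>) \<partial>M) = (\<integral>\<omega>. X 0 \<omega> * f (X 0 \<omega>) \<partial>M) + (\<integral>\<omega>. H \<omega> \<partial>M)"
    unfolding G_def using Xf[OF t] Xf[of 0] H by simp
  also have "(\<integral>\<omega>. H \<omega> \<partial>M) = (\<integral>s. (\<integral>\<omega>. P (s, \<omega>) \<partial>M) \<partial>lborel)"
    unfolding H_def using P by (intro Fubini_integral) simp
  also have "\<dots> = (LBINT s:{0..t}. \<integral>\<omega>. X 0 \<omega> * h (X s \<omega>) \<partial>M)"
    unfolding set_lebesgue_integral_def P_def
    by (intro Bochner_Integration.integral_cong) (auto simp: correlation_Y split: split_indicator)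
  finally show ?thesis .
qed

end

section \<open>Laplace transforms of correlations\<close>

text \<open>The grid point strictly after \<open>t\<close> depends on \<open>t\<close> through an integer only, so that the path
  read off there is jointly measurable.\<close>

lemma piecewise_deterministic_right_limit:
  assumes pd: "piecewise_deterministic (\<lambda>t x. x + t) x" and t: "0 \<le> t"
  shows "(\<lambda>n. x (max 0 ((of_int \<lfloor>t * real (Suc n)\<rfloor> + 1) / real (Suc n)))) \<longlonglongrightarrow> x t"
proof -
  define u where "u n = max 0 ((of_int \<lfloor>t * real (Suc n)\<rfloor> + 1) / real (Suc n))" for n
  have lo: "t < u n" for n
  proof -
    have "t * real (Suc n) < of_int \<lfloor>t * real (Suc n)\<rfloor> + 1" by linarith
    then have "t < (of_int \<lfloor>t * real (Suc n)\<rfloor> + 1) / real (Suc n)"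
      by (simp add: pos_less_divide_eq)
    then show ?thesis unfolding u_def by simp
  qed
  have hi: "u n \<le> t + inverse (real (Suc n))" for n
  proof -
    have "of_int \<lfloor>t * real (Suc n)\<rfloor> + 1 \<le> t * real (Suc n) + 1" by linarith
    then have "(of_int \<lfloor>t * real (Suc n)\<rfloor> + 1) / real (Suc n)
        \<le> (t * real (Suc n) + 1) / real (Suc n)"
      by (intro divide_right_mono) auto
    also have "\<dots> = t + inverse (real (Suc n))" by (simp add: field_simps)
    finally show ?thesis unfolding u_def using t by simp
  qed
  have u: "u \<longlonglongrightarrow> t"
  proof (rule real_tendsto_sandwich)
    show "\<forall>\<^sub>F n in sequentially. t \<le> u n" using less_imp_le[OF lo] by simp
    show "\<forall>\<^sub>F n in sequentially. u n \<le> t + inverse (real (Suc n))" using hi by simp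
    show "(\<lambda>n. t + inverse (real (Suc n))) \<longlonglongrightarrow> t"
      using tendsto_add[OF tendsto_const LIMSEQ_inverse_real_of_nat, of t] by simp
  qed simp
  have "\<exists>J. finite J \<and> (\<forall>s r. 0 \<le> s \<and> s \<le> r \<and> r \<le> t + 1 \<and> {s<..r} \<inter> J = {} \<longrightarrow> x r = x s + (r - s))"
    using pd t unfolding piecewise_deterministic_def by simp
  then obtain J where J: "finite J"
    "\<And>s r. 0 \<le> s \<Longrightarrow> s \<le> r \<Longrightarrow> r \<le> t + 1 \<Longrightarrow> {s<..r} \<inter> J = {} \<Longrightarrow> x r = x s + (r - s)"
    by blast
  \<comment> \<open>A jump at \<open>t\<close> itself is harmless: the half-open interval
    \<open>{t<..u n}\<close> leaves \<open>t\<close> out, and the path is linear there once the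
    other points of \<open>J\<close> are avoided. Staying below the horizon \<open>t + 1\<close>
    accounts for the 1 in \<open>min 1 d\<close>.\<close>
  obtain d where d: "0 < d" "\<forall>y\<in>J. y \<noteq> t \<longrightarrow> d \<le> dist t y"
    using finite_set_avoid[OF J(1)] by blast
  have "\<forall>\<^sub>F n in sequentially. u n < t + min 1 d"
    using order_tendstoD(2)[OF u, of "t + min 1 d"] d(1) by simp
  then have "\<forall>\<^sub>F n in sequentially. x t + (u n - t) = x (u n)"
  proof eventually_elim
    case (elim n)
    have "{t<..u n} \<inter> J = {}"
      using d(2) elim by (force simp: dist_real_def)
    then show ?case using J(2)[of t "u n"] t lo[of n] elim by simp
  qed
  moreover have "(\<lambda>n. x t + (u n - t)) \<longlonglongrightarrow> x t + (t - t)"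
    by (intro tendsto_intros u)
  ultimately show ?thesis
    unfolding u_def by (simp add: tendsto_cong)
qed

section \<open>Marginal laws and a jointly measurable version of the process\<close>

lemma stationary_marginal:
  assumes "strictly_stationary M X" and [measurable]: "\<And>t. 0 \<le> t \<Longrightarrow> X t \<in> borel_measurable M"
    and h: "0 \<le> h"
  shows "distr M borel (X h) = distr M borel (X 0)"
proof -
  have m: "(\<lambda>\<omega>. \<lambda>t\<in>{0..}. X (t + h) \<omega>) \<in> M \<rightarrow>\<^sub>M (\<Pi>\<^sub>M t\<in>{0..}. borel)" if "0 \<le> h" for h
    using that by (intro measurable_restrict) auto
  have e: "distr (distr M (\<Pi>\<^sub>M t\<in>{0..}. borel) (\<lambda>\<omega>. \<lambda>t\<in>{0..}. X (t + h) \<omega>)) borel (\<lambda>p. p 0)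
      = distr M borel (X h)" if "0 \<le> h" for h
    by (subst distr_distr[OF _ m[OF that]]) (auto simp: comp_def intro!: measurable_component_singleton)
  show ?thesis
    using assms(1) h e[OF h] e[of 0] unfolding strictly_stationary_def by simp
qed

lemma stationary_pdmp_normal_process:
  assumes "stationary_pdmp L M X"
  shows "\<exists>Y. normal_process M X Y"
proof -
  have pr: "prob_space M" and X: "\<And>t. 0 \<le> t \<Longrightarrow> X t \<in> borel_measurable M"
    and pd: "AE \<omega> in M. piecewise_deterministic (\<lambda>t x. x + t) (\<lambda>t. X t \<omega>)"
    and st: "strictly_stationary M X" and X0: "distributed M lborel (X 0) std_normal_density"
    using assms unfolding stationary_pdmp_def pdmp_def markov_process_def by auto
  \<comment> \<open>\<open>max 0\<close> keeps the sampled time nonnegative for every real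
    \<open>t\<close>, so that the approximants are measurable on the whole time axis. The limit is
    taken path by path, so a single null set serves all times.\<close>
  define Y where "Y t \<omega> =
    lim (\<lambda>n. X (max 0 ((of_int \<lfloor>t * real (Suc n)\<rfloor> + 1) / real (Suc n))) \<omega>)" for t \<omega>
  have step: "(\<lambda>z. X (max 0 ((of_int \<lfloor>fst z * real (Suc n)\<rfloor> + 1) / real (Suc n))) (snd z))
      \<in> borel_measurable (borel \<Otimes>\<^sub>M M)" for n
  proof (rule measurable_compose_countable[where
        f="\<lambda>i z. X (max 0 ((of_int i + 1) / real (Suc n))) (snd z)"
        and g="\<lambda>z. \<lfloor>fst z * real (Suc n)\<rfloor>"])
    show "(\<lambda>z. X (max 0 ((of_int i + 1) / real (Suc n))) (snd z)) \<in> borel_measurable (borel \<Otimes>\<^sub>M M)"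
      for i by (rule measurable_compose[OF measurable_snd X]) simp
  qed measurable
  have "(\<lambda>z. Y (fst z) (snd z)) \<in> borel_measurable (borel \<Otimes>\<^sub>M M)"
    unfolding Y_def by (rule borel_measurable_lim_metric[OF step])
  moreover have "AE \<omega> in M. \<forall>t\<ge>0. Y t \<omega> = X t \<omega>"
    using pd
  proof eventually_elim
    case (elim \<omega>)
    show ?case
      unfolding Y_def using piecewise_deterministic_right_limit[OF elim] by (auto intro!: limI)
  qed
  moreover have "distributed M lborel (X t) std_normal_density" if "0 \<le> t" for t
    using X0 stationary_marginal[OF st X that] X[OF that]
    unfolding distributed_def by (simp cong: distr_cong)
  ultimately have "normal_process M X Y"
    unfolding normal_process_def normal_process_axioms_def
    using pr by (simp add: case_prod_unfold)
  then show ?thesis by blast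
qed

text \<open>A nonnegative integrand makes integrability part of the conclusion: its nonnegative
  integral is the finite increment of \<open>F\<close>.\<close>

lemma has_bochner_integral_FTC_atLeast:
  fixes f :: "real \<Rightarrow> real"
  assumes [measurable]: "f \<in> borel_measurable borel"
    and F: "\<And>x. a \<le> x \<Longrightarrow> DERIV F x :> f x" and f: "\<And>x. a \<le> x \<Longrightarrow> 0 \<le> f x"
    and lim: "(F \<longlongrightarrow> T) at_top"
  shows "has_bochner_integral lborel (\<lambda>x. indicator {a..} x * f x) (T - F a)"
proof (rule has_bochner_integral_nn_integral)
  have mono: "F x \<le> F y" if "a \<le> x" "x \<le> y" for x y
    using that by (intro DERIV_nonneg_imp_nondecreasing[of x y F]) (auto intro: F f order_trans)
  have "F a \<le> T"
    by (rule tendsto_lowerbound[OF lim]) (auto intro!: mono eventually_mono[OF eventually_ge_at_top[of a]])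
  then show "0 \<le> T - F a" by simp
  have "(\<integral>\<^sup>+x. ennreal (indicator {a..} x * f x) \<partial>lborel) =
      (\<integral>\<^sup>+x. ennreal (f x) * indicator {a..} x \<partial>lborel)"
    by (intro nn_integral_cong) (auto split: split_indicator)
  also have "\<dots> = ennreal (T - F a)"
    by (rule nn_integral_FTC_atLeast) (auto intro: F f lim)
  finally show "(\<integral>\<^sup>+x. ennreal (indicator {a..} x * f x) \<partial>lborel) = ennreal (T - F a)" .
qed (auto simp: f split: split_indicator)

lemma has_bochner_integral_exp_atLeast:
  fixes \<rho> :: real
  assumes "0 < \<rho>"
  shows "has_bochner_integral lborel (\<lambda>t. indicator {s..} t * exp (- \<rho> * t)) (exp (- \<rho> * s) / \<rho>)"
proof -
  have "has_bochner_integral lborel (\<lambda>t. indicator {s..} t * exp (- \<rho> * t))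
      (0 - (- exp (- \<rho> * s) / \<rho>))"
  proof (rule has_bochner_integral_FTC_atLeast)
    show "((\<lambda>t. - exp (- \<rho> * t) / \<rho>) \<longlongrightarrow> 0) at_top" using assms by real_asymp
  qed (use assms in \<open>auto intro!: derivative_eq_intros simp: field_simps\<close>)
  then show ?thesis by simp
qed

text \<open>Fubini on the region \<open>0 <= s <= t\<close> takes the place of integration by parts,
  since \<open>b\<close> is merely measurable and bounded. The inner integral of
  \<open>exp (- \<rho> * t)\<close> over \<open>t >= s\<close> is
  \<open>exp (- \<rho> * s) / \<rho>\<close>.\<close>

lemma laplace_transform_antiderivative:
  fixes a b :: "real \<Rightarrow> real"
  assumes rho: "0 < \<rho>" and [measurable]: "b \<in> borel_measurable borel"
    and b: "\<And>s. 0 \<le> s \<Longrightarrow> \<bar>b s\<bar> \<le> K"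
    and a: "\<And>t. 0 \<le> t \<Longrightarrow> a t = a0 + (LBINT s:{0..t}. b s)"
  shows "set_integrable lborel {0..} (\<lambda>s. exp (- \<rho> * s) * b s)"
    and "set_integrable lborel {0..} (\<lambda>t. exp (- \<rho> * t) * a t)"
    and "\<rho> * (LBINT t:{0..}. exp (- \<rho> * t) * a t) = a0 + (LBINT s:{0..}. exp (- \<rho> * s) * b s)"
proof -
  note E = has_bochner_integral_exp_atLeast[OF rho]
  define f where "f s t = indicator {0..} s * b s * (indicator {s..} t * exp (- \<rho> * t))" for s t :: real
  have "{z :: real \<times> real. fst z \<le> snd z} \<in> sets borel"
    by (intro borel_closed closed_Collect_le continuous_intros)
  then have indm: "{(x, y). x \<le> y} \<in> sets (borel \<Otimes>\<^sub>M borel :: (real \<times> real) measure)"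
    unfolding borel_prod case_prod_unfold .
  have f_meas [measurable]: "case_prod f \<in> borel_measurable (lborel \<Otimes>\<^sub>M lborel)"
  proof -
    have "(\<lambda>z. indicator {0..} (fst z) * b (fst z) *
        (indicator {(x, y). x \<le> y} z * exp (- \<rho> * snd z))) \<in> borel_measurable (borel \<Otimes>\<^sub>M borel)"
      using indm by measurable
    also have "(\<lambda>z. indicator {0..} (fst z) * b (fst z) *
        (indicator {(x, y). x \<le> y} z * exp (- \<rho> * snd z))) = case_prod f"
      by (auto simp: f_def fun_eq_iff split: split_indicator)
    finally show ?thesis by (simp cong: measurable_cong_sets)
  qed
  have inner: "integrable lborel (f s)" "(\<integral>t. f s t \<partial>lborel) = indicator {0..} s * (b s * exp (- \<rho> * s)) / \<rho>"
    for s
    using has_bochner_integral_mult_right[OF E, of "indicator {0..} s * b s" s]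
    unfolding f_def by (auto simp: has_bochner_integral_iff)
  have inner_norm: "(\<integral>t. norm (f s t) \<partial>lborel) = indicator {0..} s * (\<bar>b s\<bar> * exp (- \<rho> * s)) / \<rho>" for s
  proof -
    have "(\<integral>t. norm (f s t) \<partial>lborel) =
        (\<integral>t. (indicator {0..} s * \<bar>b s\<bar>) * (indicator {s..} t * exp (- \<rho> * t)) \<partial>lborel)"
      by (intro Bochner_Integration.integral_cong) (auto simp: f_def abs_mult split: split_indicator)
    also have "\<dots> = (indicator {0..} s * \<bar>b s\<bar>) * (exp (- \<rho> * s) / \<rho>)"
      by (rule has_bochner_integral_integral_eq[OF has_bochner_integral_mult_right[OF E]])
    finally show ?thesis by simp
  qed
  have K: "0 \<le> K" using b[of 0] by simp
  have Eb: "integrable lborel (\<lambda>s. indicator {0..} s * (b s * exp (- \<rho> * s)))"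
  proof (rule Bochner_Integration.integrable_bound)
    show "integrable lborel (\<lambda>s. K * (indicator {0..} s * exp (- \<rho> * s)))"
      using E[of 0] by (intro integrable_mult_right) (auto simp: has_bochner_integral_iff)
    show "AE s in lborel. norm (indicator {0..} s * (b s * exp (- \<rho> * s)))
        \<le> norm (K * (indicator {0..} s * exp (- \<rho> * s)))"
      using b K by (auto simp: abs_mult split: split_indicator)
  qed measurable
  then show "set_integrable lborel {0..} (\<lambda>s. exp (- \<rho> * s) * b s)"
    unfolding set_integrable_def by (simp add: mult.commute)
  have int: "integrable (lborel \<Otimes>\<^sub>M lborel) (case_prod f)"
  proof (rule lborel_pair.Fubini_integrable[OF f_meas])
    have "integrable lborel (\<lambda>s. \<bar>indicator {0..} s * (b s * exp (- \<rho> * s))\<bar> / \<rho>)"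
      using Eb by simp
    then show "integrable lborel (\<lambda>s. \<integral>t. norm (case (s, t) of (s, t) \<Rightarrow> f s t) \<partial>lborel)"
      unfolding prod.case inner_norm by (simp add: abs_mult)
  qed (simp add: inner)
  have outer: "(\<integral>s. f s t \<partial>lborel) = indicator {0..} t * (exp (- \<rho> * t) * (LBINT s:{0..t}. b s))" for t
  proof -
    have "(\<integral>s. f s t \<partial>lborel) = (\<integral>s. exp (- \<rho> * t) * (indicator {0..t} s * b s) \<partial>lborel)"
      by (intro Bochner_Integration.integral_cong) (auto simp: f_def split: split_indicator)
    then show ?thesis
      unfolding set_lebesgue_integral_def by (cases "0 \<le> t") auto
  qed
  have Ia: "integrable lborel (\<lambda>t. indicator {0..} t * (exp (- \<rho> * t) * (LBINT s:{0..t}. b s)))"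
    using lborel_pair.integrable_snd[OF int] unfolding outer .
  have Ia0: "integrable lborel (\<lambda>t. a0 * (indicator {0..} t * exp (- \<rho> * t)))"
    using E[of 0] by (intro integrable_mult_right) (auto simp: has_bochner_integral_iff)
  have split: "(\<lambda>t. indicator {0..} t *\<^sub>R (exp (- \<rho> * t) * a t)) =
      (\<lambda>t. a0 * (indicator {0..} t * exp (- \<rho> * t)) +
        indicator {0..} t * (exp (- \<rho> * t) * (LBINT s:{0..t}. b s)))"
    by (auto simp: fun_eq_iff a algebra_simps split: split_indicator)
  show "set_integrable lborel {0..} (\<lambda>t. exp (- \<rho> * t) * a t)"
    unfolding set_integrable_def split by (intro Bochner_Integration.integrable_add Ia Ia0)
  have "(LBINT t:{0..}. exp (- \<rho> * t) * a t) = a0 / \<rho> +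
      (\<integral>t. indicator {0..} t * (exp (- \<rho> * t) * (LBINT s:{0..t}. b s)) \<partial>lborel)"
    using has_bochner_integral_integral_eq[OF E[of 0]]
    unfolding set_lebesgue_integral_def split
      Bochner_Integration.integral_add[OF Ia0 Ia, unfolded set_lebesgue_integral_def] by simp
  also have "(\<integral>t. indicator {0..} t * (exp (- \<rho> * t) * (LBINT s:{0..t}. b s)) \<partial>lborel)
      = (\<integral>s. indicator {0..} s * (b s * exp (- \<rho> * s)) / \<rho> \<partial>lborel)"
    using lborel_pair.Fubini_integral[OF int] unfolding outer inner .
  also have "\<dots> = (LBINT s:{0..}. exp (- \<rho> * s) * b s) / \<rho>"
    unfolding set_lebesgue_integral_def by (simp add: mult.commute)
  finally show "\<rho> * (LBINT t:{0..}. exp (- \<rho> * t) * a t) = a0 + (LBINT s:{0..}. exp (- \<rho> * s) * b s)"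
    using rho by (simp add: field_simps)
qed

section \<open>The resolvent identity for bounded functions and its limit\<close>

context normal_process
begin

text \<open>By Dynkin's formula the correlation \<open>a\<close> of \<open>f\<close> is an
  antiderivative of the correlation \<open>b\<close> of \<open>h\<close>, so the Laplace transform
  of \<open>\<rho> * a - b\<close> is \<open>a 0\<close>.\<close>

lemma correlation_resolvent:
  assumes gen: "extended_generator M X f h" and rho: "0 < \<rho>"
    and f: "\<And>x. \<bar>f x\<bar> \<le> B" and h: "\<And>x. \<bar>h x\<bar> \<le> C * (1 + x\<^sup>2)"
  shows "(LBINT t:{0..}. exp (- \<rho> * t) * (\<integral>\<omega>. X 0 \<omega> * (\<rho> * f (X t \<omega>) - h (X t \<omega>)) \<partial>M)) =
    (\<integral>\<omega>. X 0 \<omega> * f (X 0 \<omega>) \<partial>M)"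
proof -
  from gen have [measurable]: "f \<in> borel_measurable borel" "h \<in> borel_measurable borel"
    unfolding extended_generator_def by auto
  have B: "0 \<le> B" using f[of 0] by linarith
  have f': "\<bar>f x\<bar> \<le> B * (1 + x\<^sup>2)" for x
    by (rule order_trans[OF f]) (use B in \<open>simp add: algebra_simps\<close>)
  define a where "a t = (\<integral>\<omega>. X 0 \<omega> * f (X t \<omega>) \<partial>M)" for t
  \<comment> \<open>Defined through \<open>Y\<close> to be measurable in \<open>s\<close>; it agrees
    with the correlation of \<open>X\<close> at nonnegative times.\<close>
  define b where "b s = (\<integral>\<omega>. X 0 \<omega> * h (Y s \<omega>) \<partial>M)" for s
  have b_eq: "b s = (\<integral>\<omega>. X 0 \<omega> * h (X s \<omega>) \<partial>M)" if "0 \<le> s" for s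
    unfolding b_def using that by (rule correlation_Y) simp
  have [measurable]: "b \<in> borel_measurable borel" unfolding b_def by measurable
  have bb: "\<bar>b s\<bar> \<le> C * gauss_const" if "0 \<le> s" for s
    unfolding b_eq[OF that] by (rule correlation_bound(3)[OF that _ h]) simp
  have ab: "a t = a 0 + (LBINT s:{0..t}. b s)" if "0 \<le> t" for t
    unfolding a_def dynkin[OF gen f h that] set_lebesgue_integral_def
    by (auto simp: b_eq intro!: Bochner_Integration.integral_cong split: split_indicator)
  note lap = laplace_transform_antiderivative[OF rho _ bb ab, simplified]
  have "(LBINT t:{0..}. exp (- \<rho> * t) * (\<integral>\<omega>. X 0 \<omega> * (\<rho> * f (X t \<omega>) - h (X t \<omega>)) \<partial>M)) =
      (LBINT t:{0..}. \<rho> * (exp (- \<rho> * t) * a t) - exp (- \<rho> * t) * b t)"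
  proof (rule set_lebesgue_integral_cong)
    show "\<forall>t. t \<in> {0..} \<longrightarrow> exp (- \<rho> * t) * (\<integral>\<omega>. X 0 \<omega> * (\<rho> * f (X t \<omega>) - h (X t \<omega>)) \<partial>M) =
        \<rho> * (exp (- \<rho> * t) * a t) - exp (- \<rho> * t) * b t"
    proof (intro allI impI)
      fix t :: real assume "t \<in> {0..}"
      then have t: "0 \<le> t" by simp
      have "(\<integral>\<omega>. X 0 \<omega> * (\<rho> * f (X t \<omega>) - h (X t \<omega>)) \<partial>M) =
          (\<integral>\<omega>. \<rho> * (X 0 \<omega> * f (X t \<omega>)) - X 0 \<omega> * h (X t \<omega>) \<partial>M)"
        by (simp add: algebra_simps)
      also have "\<dots> = \<rho> * a t - b t"
        unfolding a_def b_eq[OF t]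
        using correlation_bound(1)[OF t _ f'] correlation_bound(1)[OF t _ h] by simp
      finally have "(\<integral>\<omega>. X 0 \<omega> * (\<rho> * f (X t \<omega>) - h (X t \<omega>)) \<partial>M) = \<rho> * a t - b t" .
      then show "exp (- \<rho> * t) * (\<integral>\<omega>. X 0 \<omega> * (\<rho> * f (X t \<omega>) - h (X t \<omega>)) \<partial>M) =
        \<rho> * (exp (- \<rho> * t) * a t) - exp (- \<rho> * t) * b t"
        by (simp only: right_diff_distrib mult.left_commute)
    qed
  qed simp
  also have "\<dots> = \<rho> * (LBINT t:{0..}. exp (- \<rho> * t) * a t) - (LBINT t:{0..}. exp (- \<rho> * t) * b t)"
    using lap(1,2) by (subst set_integral_diff) auto
  also have "\<dots> = a 0" using lap(3) by simp
  finally show ?thesis unfolding a_def .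
qed

lemma correlation_tendsto:
  assumes t: "0 \<le> t" and p [measurable]: "\<And>n. p n \<in> borel_measurable borel"
    and bd: "\<And>n x. \<bar>p n x\<bar> \<le> C * (1 + x\<^sup>2)" and lim: "\<And>x. (\<lambda>n. p n x) \<longlonglongrightarrow> q x"
  shows "(\<lambda>n. \<integral>\<omega>. X 0 \<omega> * p n (X t \<omega>) \<partial>M) \<longlonglongrightarrow> (\<integral>\<omega>. X 0 \<omega> * q (X t \<omega>) \<partial>M)"
proof (rule integral_dominated_convergence)
  note [measurable] = X_borel[OF t]
  have [measurable]: "q \<in> borel_measurable borel"
    by (rule borel_measurable_LIMSEQ_metric[OF p]) (rule lim)
  show "(\<lambda>\<omega>. X 0 \<omega> * q (X t \<omega>)) \<in> borel_measurable M"
    "\<And>n. (\<lambda>\<omega>. X 0 \<omega> * p n (X t \<omega>)) \<in> borel_measurable M" by measurable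
  show "integrable M (\<lambda>\<omega>. C * (gauss_weight (X 0 \<omega>) + gauss_weight (X t \<omega>)) / 2)"
    by (intro integrable_divide integrable_mult_right Bochner_Integration.integrable_add
        gauss_weight_X t) simp
  show "AE \<omega> in M. norm (X 0 \<omega> * p n (X t \<omega>)) \<le>
      C * (gauss_weight (X 0 \<omega>) + gauss_weight (X t \<omega>)) / 2" for n
    unfolding real_norm_def by (rule AE_I2) (rule mult_le_gauss_weight[OF bd])
  show "AE \<omega> in M. (\<lambda>n. X 0 \<omega> * p n (X t \<omega>)) \<longlonglongrightarrow> X 0 \<omega> * q (X t \<omega>)"
    by (intro AE_I2 tendsto_intros lim)
qed

text \<open>The bounds \<open>B n\<close> may blow up with \<open>n\<close>; they only bring each
  \<open>f n\<close> within reach of the resolvent identity. The quadratic bound, uniform in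
  \<open>n\<close>, drives dominated convergence both under the expectation and in time.\<close>

lemma correlation_resolvent_limit:
  assumes rho: "0 < \<rho>" and gen: "\<And>n. extended_generator M X (f n) (h n)"
    and fB: "\<And>n x. \<bar>f n x\<bar> \<le> B n" and f: "\<And>n x. \<bar>f n x\<bar> \<le> C * (1 + x\<^sup>2)"
    and h: "\<And>n x. \<bar>h n x\<bar> \<le> C * (1 + x\<^sup>2)"
    and fg: "\<And>x. (\<lambda>n. f n x) \<longlonglongrightarrow> g x" and hq: "\<And>x. (\<lambda>n. \<rho> * f n x - h n x) \<longlonglongrightarrow> q x"
  shows "(LBINT t:{0..}. exp (- \<rho> * t) * (\<integral>\<omega>. X 0 \<omega> * q (X t \<omega>) \<partial>M)) =
    (\<integral>\<omega>. X 0 \<omega> * g (X 0 \<omega>) \<partial>M)"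
proof -
  from gen have [measurable]: "f n \<in> borel_measurable borel" "h n \<in> borel_measurable borel" for n
    unfolding extended_generator_def by auto
  define p where "p n x = \<rho> * f n x - h n x" for n x
  have [measurable]: "p n \<in> borel_measurable borel" for n unfolding p_def by measurable
  define D where "D = (\<rho> + 1) * C"
  have p: "\<bar>p n x\<bar> \<le> D * (1 + x\<^sup>2)" for n x
  proof -
    have "\<bar>p n x\<bar> \<le> \<rho> * \<bar>f n x\<bar> + \<bar>h n x\<bar>"
      unfolding p_def using abs_triangle_ineq4[of "\<rho> * f n x" "h n x"] rho by (simp add: abs_mult)
    also have "\<dots> \<le> \<rho> * (C * (1 + x\<^sup>2)) + C * (1 + x\<^sup>2)"
      using rho by (intro add_mono mult_left_mono f h) auto
    finally show ?thesis unfolding D_def by (simp add: algebra_simps)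
  qed
  have pq: "(\<lambda>n. p n x) \<longlonglongrightarrow> q x" for x unfolding p_def by (rule hq)
  have [measurable]: "q \<in> borel_measurable borel"
    by (rule borel_measurable_LIMSEQ_metric[where f=p]) (auto intro: pq)
  have sI: "indicator {0..} t * (exp (- \<rho> * t) * (\<integral>\<omega>. X 0 \<omega> * r (X t \<omega>) \<partial>M)) =
     indicator {0..} t * (exp (- \<rho> * t) * (\<integral>\<omega>. X 0 \<omega> * r (Y t \<omega>) \<partial>M))"
    if [measurable]: "r \<in> borel_measurable borel" for r t
    by (auto simp: correlation_Y split: split_indicator)
  have "(\<lambda>n. LBINT t:{0..}. exp (- \<rho> * t) * (\<integral>\<omega>. X 0 \<omega> * p n (X t \<omega>) \<partial>M)) \<longlonglongrightarrow>
      (LBINT t:{0..}. exp (- \<rho> * t) * (\<integral>\<omega>. X 0 \<omega> * q (X t \<omega>) \<partial>M))"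
    unfolding set_lebesgue_integral_def real_scaleR_def
  proof (rule integral_dominated_convergence)
    show "(\<lambda>t. indicator {0..} t * (exp (- \<rho> * t) * (\<integral>\<omega>. X 0 \<omega> * q (X t \<omega>) \<partial>M)))
        \<in> borel_measurable lborel"
      by (subst sI) measurable
    show "(\<lambda>t. indicator {0..} t * (exp (- \<rho> * t) * (\<integral>\<omega>. X 0 \<omega> * p n (X t \<omega>) \<partial>M)))
        \<in> borel_measurable lborel" for n
      by (subst sI) measurable
    show "integrable lborel (\<lambda>t. (indicator {0..} t * exp (- \<rho> * t)) * (D * gauss_const))"
      using has_bochner_integral_exp_atLeast[OF rho, of 0]
      by (intro integrable_mult_left) (auto simp: has_bochner_integral_iff)
    show "AE t in lborel. norm (indicator {0..} t * (exp (- \<rho> * t) * (\<integral>\<omega>. X 0 \<omega> * p n (X t \<omega>) \<partial>M)))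
        \<le> indicator {0..} t * exp (- \<rho> * t) * (D * gauss_const)" for n
    proof (rule AE_I2)
      fix t :: real
      show "norm (indicator {0..} t * (exp (- \<rho> * t) * (\<integral>\<omega>. X 0 \<omega> * p n (X t \<omega>) \<partial>M)))
        \<le> indicator {0..} t * exp (- \<rho> * t) * (D * gauss_const)"
        using correlation_bound(3)[of t "p n" D] p
        by (auto simp: abs_mult split: split_indicator)
    qed
    show "AE t in lborel. (\<lambda>n. indicator {0..} t * (exp (- \<rho> * t) * (\<integral>\<omega>. X 0 \<omega> * p n (X t \<omega>) \<partial>M)))
        \<longlonglongrightarrow> indicator {0..} t * (exp (- \<rho> * t) * (\<integral>\<omega>. X 0 \<omega> * q (X t \<omega>) \<partial>M))"
    proof (rule AE_I2)
      fix t :: real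
      show "(\<lambda>n. indicator {0..} t * (exp (- \<rho> * t) * (\<integral>\<omega>. X 0 \<omega> * p n (X t \<omega>) \<partial>M)))
        \<longlonglongrightarrow> indicator {0..} t * (exp (- \<rho> * t) * (\<integral>\<omega>. X 0 \<omega> * q (X t \<omega>) \<partial>M))"
      proof (cases "0 \<le> t")
        case True
        have "(\<lambda>n. \<integral>\<omega>. X 0 \<omega> * p n (X t \<omega>) \<partial>M) \<longlonglongrightarrow> (\<integral>\<omega>. X 0 \<omega> * q (X t \<omega>) \<partial>M)"
          by (rule correlation_tendsto[OF True _ p pq]) simp
        then show ?thesis by (intro tendsto_intros)
      qed simp
    qed
  qed
  also have "(\<lambda>n. LBINT t:{0..}. exp (- \<rho> * t) * (\<integral>\<omega>. X 0 \<omega> * p n (X t \<omega>) \<partial>M)) =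
      (\<lambda>n. \<integral>\<omega>. X 0 \<omega> * f n (X 0 \<omega>) \<partial>M)"
    unfolding p_def using correlation_resolvent[OF gen rho fB h] by simp
  finally have 1: "(\<lambda>n. \<integral>\<omega>. X 0 \<omega> * f n (X 0 \<omega>) \<partial>M) \<longlonglongrightarrow>
      (LBINT t:{0..}. exp (- \<rho> * t) * (\<integral>\<omega>. X 0 \<omega> * q (X t \<omega>) \<partial>M))" .
  have "(\<lambda>n. \<integral>\<omega>. X 0 \<omega> * f n (X 0 \<omega>) \<partial>M) \<longlonglongrightarrow> (\<integral>\<omega>. X 0 \<omega> * g (X 0 \<omega>) \<partial>M)"
    by (rule correlation_tendsto[OF _ _ f fg]) auto
  with 1 show ?thesis by (rule LIMSEQ_unique)
qed

end

section \<open>The Mills ratio and Gaussian integrals on the half line\<close>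

definition gauss_tail :: "real \<Rightarrow> real" where
  "gauss_tail a = (LBINT t:{a..}. exp (- t\<^sup>2 / 2))"

text \<open>The substitution \<open>t = a + u\<close> in the tail turns this into the integral of
  \<open>exp (- a u - u^2 / 2)\<close> over \<open>u > 0\<close>. In the present form the
  differential equation is just the product rule.\<close>

definition mills :: "real \<Rightarrow> real" where
  "mills a = exp (a\<^sup>2 / 2) * gauss_tail a"

lemma Omega_eq_mills: "Omega \<rho> = \<rho> * mills \<rho>"
  unfolding Omega_def mills_def gauss_tail_def by simp

lemma integrable_gauss: "integrable lborel (\<lambda>t::real. exp (- t\<^sup>2 / 2))"
proof -
  have "integrable lborel (\<lambda>t::real. sqrt (2 * pi) * std_normal_density t)"
    by (intro integrable_mult_right) simp
  then show ?thesis by (simp add: std_normal_density_def)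
qed

lemma set_integrable_gauss: "S \<in> sets borel \<Longrightarrow> set_integrable lborel S (\<lambda>t::real. exp (- t\<^sup>2 / 2))"
  unfolding set_integrable_def using integrable_gauss by (intro integrable_mult_indicator) auto

text \<open>Near \<open>a\<close> the tail is its value at \<open>b\<close> minus an integral over
  \<open>[b, x]\<close>, to which the fundamental theorem of calculus applies.\<close>

lemma DERIV_gauss_tail: "(gauss_tail has_real_derivative - exp (- a\<^sup>2 / 2)) (at a)"
proof -
  define b c where "b = a - 1" and "c = a + 1"
  let ?f = "\<lambda>t::real. exp (- t\<^sup>2 / 2)"
  have eq: "gauss_tail b - integral {b..x} ?f = gauss_tail x" if "x \<in> {b<..<c}" for x
  proof -
    have "{b..} = {b..<x} \<union> {x..}" using that by auto
    then have "gauss_tail b = (LBINT t:{b..<x}. ?f t) + gauss_tail x"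
      unfolding gauss_tail_def
      by (simp only:, intro set_integral_Un set_integrable_gauss, auto)
    also have "(LBINT t:{b..<x}. ?f t) = (LBINT t:{b..x}. ?f t)"
      unfolding set_lebesgue_integral_def
      by (intro integral_cong_AE)
         (use AE_lborel_singleton[of x] in \<open>auto elim!: eventually_mono split: split_indicator\<close>)
    also have "\<dots> = integral {b..x} ?f"
      by (rule set_borel_integral_eq_integral(2)[OF set_integrable_gauss]) simp
    finally show ?thesis by simp
  qed
  have "((\<lambda>x. integral {b..x} ?f) has_real_derivative ?f a) (at a within {b..c})"
    by (rule integral_has_real_derivative) (auto simp: b_def c_def intro!: continuous_intros)
  then have "((\<lambda>x. integral {b..x} ?f) has_real_derivative ?f a) (at a)"
    by (subst (asm) at_within_Icc_at) (simp_all add: b_def c_def)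
  then have "((\<lambda>x. gauss_tail b - integral {b..x} ?f) has_real_derivative 0 - ?f a) (at a)"
    by (intro DERIV_diff DERIV_const)
  then have "((\<lambda>x. gauss_tail b - integral {b..x} ?f) has_real_derivative - ?f a) (at a)"
    by simp
  then show ?thesis
    by (rule has_field_derivative_transform_within_open[OF _ _ _ eq, where S="{b<..<c}"])
       (auto simp: b_def c_def)
qed

lemmas DERIV_gauss_tail' [derivative_intros] = DERIV_chain2[OF DERIV_gauss_tail]

lemma DERIV_mills: "(mills has_real_derivative a * mills a - 1) (at a)"
proof -
  have "((\<lambda>a. exp (a\<^sup>2 / 2) * gauss_tail a) has_real_derivative a * mills a - 1) (at a)"
    by (auto intro!: derivative_eq_intros simp: mills_def algebra_simps simp flip: exp_add)
  then show ?thesis unfolding mills_def[abs_def] .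
qed

lemmas DERIV_mills' [derivative_intros] = DERIV_chain2[OF DERIV_mills]

lemma continuous_on_mills: "continuous_on S mills"
  by (meson DERIV_mills DERIV_isCont continuous_at_imp_continuous_on)

lemma borel_measurable_mills [measurable]: "mills \<in> borel_measurable borel"
  by (rule borel_measurable_continuous_onI[OF continuous_on_mills])

lemma has_bochner_integral_gauss_mean_atLeast:
  "has_bochner_integral lborel (\<lambda>x::real. indicator {a..} x * (x * exp (- x\<^sup>2 / 2))) (exp (- a\<^sup>2 / 2))"
  if "0 \<le> a"
proof -
  have "has_bochner_integral lborel (\<lambda>x::real. indicator {a..} x * (x * exp (- x\<^sup>2 / 2)))
      (0 - (- exp (- a\<^sup>2 / 2)))"
  proof (rule has_bochner_integral_FTC_atLeast)
    show "((\<lambda>x::real. - exp (- x\<^sup>2 / 2)) \<longlongrightarrow> 0) at_top" by real_asymp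
  qed (use that in \<open>auto intro!: derivative_eq_intros\<close>)
  then show ?thesis by simp
qed

lemma gauss_tail_0: "gauss_tail 0 = sqrt (pi / 2)"
proof -
  have "has_bochner_integral lborel (\<lambda>x. indicator {0..} x *\<^sub>R exp (- x\<^sup>2)) (sqrt pi / 2)"
    by (rule gaussian_moment_0)
  then have "has_bochner_integral lborel
      (\<lambda>x. indicator {0..} (0 + 1 / sqrt 2 * x) *\<^sub>R exp (- (0 + 1 / sqrt 2 * x)\<^sup>2))
      ((sqrt pi / 2) /\<^sub>R \<bar>1 / sqrt 2\<bar>)"
    by (subst (asm) lborel_has_bochner_integral_real_affine_iff[where c="1 / sqrt 2" and t=0]) simp_all
  also have "(\<lambda>x::real. indicator {0..} (0 + 1 / sqrt 2 * x) *\<^sub>R exp (- (0 + 1 / sqrt 2 * x)\<^sup>2)) =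
      (\<lambda>x. indicator {0..} x *\<^sub>R exp (- x\<^sup>2 / 2))"
    by (auto simp: fun_eq_iff power_divide zero_le_divide_iff split: split_indicator)
  also have "(sqrt pi / 2) /\<^sub>R \<bar>1 / sqrt 2\<bar> = sqrt (pi / 2)"
    by (simp add: real_sqrt_divide field_simps)
  finally show ?thesis
    unfolding gauss_tail_def set_lebesgue_integral_def by (rule has_bochner_integral_integral_eq)
qed

text \<open>A nonnegative strictly decreasing function cannot vanish.\<close>

lemma gauss_tail_pos: "0 < gauss_tail a"
proof -
  have nn: "0 \<le> gauss_tail x" for x
    unfolding gauss_tail_def set_lebesgue_integral_def by (intro integral_nonneg_AE) simp
  have "gauss_tail (a + 1) < gauss_tail a"
    by (rule DERIV_neg_imp_decreasing[of a "a + 1"]) (auto intro!: exI DERIV_gauss_tail)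
  then show ?thesis using nn[of "a + 1"] by linarith
qed

lemma mills_pos: "0 < mills a"
  unfolding mills_def using gauss_tail_pos by simp

text \<open>On \<open>[a, \<infinity>)\<close> the factor \<open>x / a\<close> is at least 1, and
  with it the integrand has an elementary antiderivative.\<close>

lemma gauss_tail_le:
  assumes "0 < a"
  shows "gauss_tail a \<le> exp (- a\<^sup>2 / 2) / a"
proof -
  note m = has_bochner_integral_gauss_mean_atLeast[OF less_imp_le[OF assms]]
  have "gauss_tail a \<le> (\<integral>x. (indicator {a..} x * (x * exp (- x\<^sup>2 / 2))) / a \<partial>lborel)"
    unfolding gauss_tail_def set_lebesgue_integral_def
  proof (rule integral_mono)
    show "integrable lborel (\<lambda>t::real. indicator {a..} t *\<^sub>R exp (- t\<^sup>2 / 2))"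
      using set_integrable_gauss[of "{a..}"] unfolding set_integrable_def by simp
    show "integrable lborel (\<lambda>x. indicator {a..} x * (x * exp (- x\<^sup>2 / 2)) / a)"
      using m by (intro integrable_divide) (auto simp: has_bochner_integral_iff)
  qed (use assms in \<open>auto simp: field_simps split: split_indicator\<close>)
  also have "\<dots> = exp (- a\<^sup>2 / 2) / a"
    using m by (simp add: has_bochner_integral_iff)
  finally show ?thesis .
qed

lemma mills_le:
  assumes "0 < a"
  shows "mills a \<le> 1 / a"
proof -
  have "mills a \<le> exp (a\<^sup>2 / 2) * (exp (- a\<^sup>2 / 2) / a)"
    unfolding mills_def by (intro mult_left_mono gauss_tail_le assms) simp
  also have "\<dots> = 1 / a" by (simp flip: exp_add)
  finally show ?thesis .
qed

lemma Omega_pos: "0 < \<rho> \<Longrightarrow> 0 < Omega \<rho>"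
  unfolding Omega_eq_mills by (simp add: mills_pos)

text \<open>Together with positivity this keeps \<open>Omega \<rho> * (2 - Omega \<rho>)\<close>, a
  denominator of the forward formula, away from 0.\<close>

lemma Omega_le_1: "0 < \<rho> \<Longrightarrow> Omega \<rho> \<le> 1"
  unfolding Omega_eq_mills using mills_le[of \<rho>] by (simp add: field_simps)

lemma abs_mills_shift_le: "0 < c \<Longrightarrow> 0 \<le> x \<Longrightarrow> \<bar>mills (c + x)\<bar> \<le> 1 / c"
  using order_trans[OF mills_le[of "c + x"] frac_le[of 1 1 c "c + x"]] less_imp_le[OF mills_pos[of "c + x"]]
  by simp

text \<open>\<open>mills\<close> is bounded on \<open>[c, \<infinity>)\<close>, so boundary terms at
  infinity reduce to elementary limits.\<close>

lemma tendsto_mult_mills_0: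
  assumes c: "0 < c" and f: "(f \<longlongrightarrow> 0) at_top"
  shows "((\<lambda>x. f x * mills (c + x)) \<longlongrightarrow> 0) at_top"
proof (rule Lim_null_comparison)
  show "\<forall>\<^sub>F x in at_top. norm (f x * mills (c + x)) \<le> \<bar>f x\<bar> * (1 / c)"
    using eventually_ge_at_top[of 0]
    unfolding real_norm_def abs_mult
    by eventually_elim (rule mult_left_mono[OF abs_mills_shift_le[OF c] abs_ge_zero])
  show "((\<lambda>x. \<bar>f x\<bar> * (1 / c)) \<longlongrightarrow> 0) at_top"
    using tendsto_mult_left_zero[OF tendsto_rabs_zero[OF f]] .
qed

lemma gauss_tail_tendsto_0: "(gauss_tail \<longlongrightarrow> 0) at_top"
proof (rule Lim_null_comparison)
  show "\<forall>\<^sub>F x in at_top. norm (gauss_tail x) \<le> exp (- x\<^sup>2 / 2) / x"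
    using eventually_gt_at_top[of 0]
    unfolding real_norm_def abs_of_pos[OF gauss_tail_pos]
    by eventually_elim (rule gauss_tail_le)
  show "((\<lambda>x::real. exp (- x\<^sup>2 / 2) / x) \<longlongrightarrow> 0) at_top" by real_asymp
qed

section \<open>Half-line Gaussian integrals with explicit antiderivatives\<close>

lemma has_bochner_integral_gauss_mean:
  "has_bochner_integral lborel (\<lambda>x::real. indicator {0..} x * (x * exp (- x\<^sup>2 / 2))) 1"
  using has_bochner_integral_gauss_mean_atLeast[of 0] by simp

lemma has_bochner_integral_gauss_second_moment:
  "has_bochner_integral lborel (\<lambda>x. indicator {0..} x * (x\<^sup>2 * exp (- x\<^sup>2 / 2))) (sqrt (pi / 2))"
proof -
  have "has_bochner_integral lborel (\<lambda>x. indicator {0..} x * (x\<^sup>2 * exp (- x\<^sup>2 / 2)))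
      (0 - (- 0 * exp (- 0\<^sup>2 / 2) - gauss_tail 0))"
  proof (rule has_bochner_integral_FTC_atLeast)
    have "((\<lambda>x::real. - x * exp (- x\<^sup>2 / 2)) \<longlongrightarrow> 0) at_top" by real_asymp
    from tendsto_diff[OF this gauss_tail_tendsto_0]
    show "((\<lambda>x. - x * exp (- x\<^sup>2 / 2) - gauss_tail x) \<longlongrightarrow> 0) at_top" by simp
  qed (auto intro!: derivative_eq_intros simp: power2_eq_square)
  then show ?thesis by (simp add: gauss_tail_0)
qed

context
  fixes \<rho> :: real
  assumes rho: "0 < \<rho>"
begin

text \<open>With \<open>e x = exp (- \<rho> x - x^2 / 2)\<close>, the derivative of
  \<open>e x * mills (\<rho> + x)\<close> is \<open>- e x\<close>. Hence \<open>- e x\<close> is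
  corrected by \<rho> times this product to give an antiderivative of
  \<open>x * e x\<close>.\<close>

lemma has_bochner_integral_exp_gauss_mean:
  "has_bochner_integral lborel (\<lambda>x. indicator {0..} x * (x * exp (- \<rho> * x) * exp (- x\<^sup>2 / 2)))
    (1 - Omega \<rho>)"
proof -
  have "has_bochner_integral lborel (\<lambda>x. indicator {0..} x * (x * exp (- \<rho> * x) * exp (- x\<^sup>2 / 2)))
    (0 - (\<rho> * (exp (- \<rho> * 0) * exp (- 0\<^sup>2 / 2) * mills (\<rho> + 0)) - exp (- \<rho> * 0) * exp (- 0\<^sup>2 / 2)))"
  proof (rule has_bochner_integral_FTC_atLeast)
    have 0: "((\<lambda>x. exp (- \<rho> * x) * exp (- x\<^sup>2 / 2)) \<longlongrightarrow> 0) at_top" using rho by real_asymp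
    from tendsto_diff[OF tendsto_mult_right_zero[OF tendsto_mult_mills_0[OF rho 0], of \<rho>] 0]
    show "((\<lambda>x. \<rho> * (exp (- \<rho> * x) * exp (- x\<^sup>2 / 2) * mills (\<rho> + x)) - exp (- \<rho> * x) * exp (- x\<^sup>2 / 2)) \<longlongrightarrow> 0) at_top"
      by simp
  qed (auto intro!: derivative_eq_intros simp: algebra_simps)
  then show ?thesis by (simp add: Omega_eq_mills)
qed

text \<open>In the derivative of \<open>p = exp (- x^2 / 2) * mills (\<rho> + x)\<close> the terms
  with factor \<open>x\<close> cancel, leaving \<open>p' = \<rho> p - exp (- x^2 / 2)\<close>.
  Solving this for \<open>p\<close>, and the derivative of \<open>x p\<close> for
  \<open>x p\<close>, produces the antiderivative \<open>?F\<close>.\<close>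

lemma has_bochner_integral_mills_gauss_mean:
  "has_bochner_integral lborel (\<lambda>x. indicator {0..} x * (x * mills (\<rho> + x) * exp (- x\<^sup>2 / 2)))
    (mills \<rho> / \<rho>\<^sup>2 + 1 / \<rho> - sqrt (pi / 2) / \<rho>\<^sup>2)"
proof -
  let ?F = "\<lambda>x. ((x / \<rho> - 1 / \<rho>\<^sup>2) * exp (- x\<^sup>2 / 2)) * mills (\<rho> + x) - exp (- x\<^sup>2 / 2) / \<rho>
      + gauss_tail x / \<rho>\<^sup>2"
  have "has_bochner_integral lborel (\<lambda>x. indicator {0..} x * (x * mills (\<rho> + x) * exp (- x\<^sup>2 / 2)))
    (0 - ?F 0)"
  proof (rule has_bochner_integral_FTC_atLeast)
    have 0: "((\<lambda>x. (x / \<rho> - 1 / \<rho>\<^sup>2) * exp (- x\<^sup>2 / 2)) \<longlongrightarrow> 0) at_top" using rho by real_asymp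
    have 1: "((\<lambda>x. exp (- x\<^sup>2 / 2) / \<rho>) \<longlongrightarrow> 0) at_top" using rho by real_asymp
    from tendsto_add[OF tendsto_diff[OF tendsto_mult_mills_0[OF rho 0] 1]
      tendsto_divide_zero[OF gauss_tail_tendsto_0, of "\<rho>\<^sup>2"]]
    show "(?F \<longlongrightarrow> 0) at_top" by simp
    show "(?F has_real_derivative x * mills (\<rho> + x) * exp (- x\<^sup>2 / 2)) (at x)" for x
      using rho by (auto intro!: derivative_eq_intros simp: field_simps power2_eq_square)
  qed (auto intro!: mult_nonneg_nonneg less_imp_le[OF mills_pos])
  moreover have "0 - ?F 0 = mills \<rho> / \<rho>\<^sup>2 + 1 / \<rho> - sqrt (pi / 2) / \<rho>\<^sup>2"
    by (simp add: gauss_tail_0)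
  ultimately show ?thesis by (simp only:)
qed

text \<open>The cancellation persists: \<open>p = ?e x * mills (2 * \<rho> + x)\<close> satisfies
  \<open>p' = \<rho> p - ?e x\<close>. The antiderivatives of \<open>?e x\<close> and
  \<open>x * ?e x\<close> this calls for bring in \<open>mills (\<rho> + x)\<close>.\<close>

lemma has_bochner_integral_exp_mills_gauss_mean:
  "has_bochner_integral lborel
    (\<lambda>x. indicator {0..} x * (x * exp (- \<rho> * x) * mills (2 * \<rho> + x) * exp (- x\<^sup>2 / 2)))
    ((1 - Omega \<rho>) / \<rho> - mills \<rho> / \<rho>\<^sup>2 + mills (2 * \<rho>) / \<rho>\<^sup>2)"
proof -
  let ?e = "\<lambda>x. exp (- \<rho> * x) * exp (- x\<^sup>2 / 2)"
  let ?F = "\<lambda>x. ((x / \<rho> - 1 / \<rho>\<^sup>2) * ?e x) * mills (2 * \<rho> + x) - ?e x / \<rho>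
      + ((1 + 1 / \<rho>\<^sup>2) * ?e x) * mills (\<rho> + x)"
  have "has_bochner_integral lborel
    (\<lambda>x. indicator {0..} x * (x * exp (- \<rho> * x) * mills (2 * \<rho> + x) * exp (- x\<^sup>2 / 2))) (0 - ?F 0)"
  proof (rule has_bochner_integral_FTC_atLeast)
    have 0: "((\<lambda>x. (x / \<rho> - 1 / \<rho>\<^sup>2) * ?e x) \<longlongrightarrow> 0) at_top" using rho by real_asymp
    have 1: "((\<lambda>x. ?e x / \<rho>) \<longlongrightarrow> 0) at_top" using rho by real_asymp
    have 2: "((\<lambda>x. (1 + 1 / \<rho>\<^sup>2) * ?e x) \<longlongrightarrow> 0) at_top" using rho by real_asymp
    from tendsto_add[OF tendsto_diff[OF tendsto_mult_mills_0[OF _ 0, of "2 * \<rho>"] 1]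
      tendsto_mult_mills_0[OF rho 2]] rho
    show "(?F \<longlongrightarrow> 0) at_top" by simp
    show "(?F has_real_derivative x * exp (- \<rho> * x) * mills (2 * \<rho> + x) * exp (- x\<^sup>2 / 2)) (at x)" for x
      using rho by (auto intro!: derivative_eq_intros simp: field_simps power2_eq_square)
  qed (auto intro!: mult_nonneg_nonneg less_imp_le[OF mills_pos])
  moreover have "0 - ?F 0 = (1 - Omega \<rho>) / \<rho> - mills \<rho> / \<rho>\<^sup>2 + mills (2 * \<rho>) / \<rho>\<^sup>2"
    using rho by (simp add: Omega_eq_mills field_simps)
  ultimately show ?thesis by (simp only:)
qed

end

text \<open>Reflection moves the second integral to the negative half line. Both halves contain 0,
  so the splitting holds only almost everywhere.\<close>

lemma has_bochner_integral_halves: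
  fixes f :: "real \<Rightarrow> real"
  assumes A: "has_bochner_integral lborel (\<lambda>x. indicator {0..} x * f x) A"
    and B: "has_bochner_integral lborel (\<lambda>x. indicator {0..} x * f (- x)) B"
    and [measurable]: "f \<in> borel_measurable borel"
  shows "has_bochner_integral lborel f (A + B)"
proof -
  have B': "has_bochner_integral lborel (\<lambda>x. indicator {0..} (- x) * f x) B"
    using lborel_has_bochner_integral_real_affine_iff[where c="-1::real" and t=0 and x=B
        and f="\<lambda>x. indicator {0..} x * f (- x)"] B by simp
  have "AE x in lborel. indicator {0..} x * f x + indicator {0..} (- x) * f x = f x"
    using AE_lborel_singleton[of "0::real"] by eventually_elim (auto split: split_indicator)
  note cong = has_bochner_integral_cong_AE[OF _ _ this]
  show ?thesis
    by (rule iffD1[OF cong has_bochner_integral_add[OF A B']]) measurable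
qed

lemma DERIV_glue:
  fixes l r :: "real \<Rightarrow> real"
  assumes l: "\<And>x. (l has_real_derivative l' x) (at x)"
    and r: "\<And>x. (r has_real_derivative r' x) (at x)"
    and eq: "l 0 = r 0" "l' 0 = r' 0"
  shows "((\<lambda>x. if x \<le> 0 then l x else r x) has_real_derivative (if x \<le> 0 then l' x else r' x)) (at x)"
proof (cases x "0::real" rule: linorder_cases)
  case less
  then show ?thesis
    using has_field_derivative_transform_within_open[OF l[of x], of "{..<0}" "\<lambda>x. if x \<le> 0 then l x else r x"]
    by simp
next
  case greater
  then show ?thesis
    using has_field_derivative_transform_within_open[OF r[of x], of "{0<..}" "\<lambda>x. if x \<le> 0 then l x else r x"]
    by simp
next
  case equal
  have "((\<lambda>y. ((if y \<le> 0 then l y else r y) - l 0) / (y - 0)) \<longlongrightarrow> l' 0) (at 0)"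
  proof (rule filterlim_split_at)
    have "((\<lambda>y. (l y - l 0) / (y - 0)) \<longlongrightarrow> l' 0) (at_left 0)"
      using l[of 0] unfolding has_field_derivative_iff
      by (rule tendsto_mono[rotated]) (simp add: at_le)
    then show "((\<lambda>y. ((if y \<le> 0 then l y else r y) - l 0) / (y - 0)) \<longlongrightarrow> l' 0) (at_left 0)"
      by (rule Lim_transform_eventually)
         (simp add: eventually_at_filter)
    have "((\<lambda>y. (r y - r 0) / (y - 0)) \<longlongrightarrow> r' 0) (at_right 0)"
      using r[of 0] unfolding has_field_derivative_iff
      by (rule tendsto_mono[rotated]) (simp add: at_le)
    then show "((\<lambda>y. ((if y \<le> 0 then l y else r y) - l 0) / (y - 0)) \<longlongrightarrow> l' 0) (at_right 0)"
      unfolding eq by (rule Lim_transform_eventually)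
         (simp add: eventually_at_filter)
  qed
  then show ?thesis unfolding equal has_field_derivative_iff by (simp only: order_refl if_True)
qed

section \<open>The resolvent equation\<close>

text \<open>A smooth cutoff: for \<open>e > 0\<close> it turns linear growth into boundedness and
  preserves \<open>C1\<close>, while never increasing absolute values, so that estimates stay
  uniform in \<open>e\<close>.\<close>

definition damp :: "real \<Rightarrow> (real \<Rightarrow> real) \<Rightarrow> real \<Rightarrow> real" where
  "damp e g x = g x / (1 + e * x\<^sup>2)"

lemma damp_denominator_ge_1: "0 \<le> e \<Longrightarrow> 1 \<le> 1 + e * (x::real)\<^sup>2"
  by simp

lemma abs_divide_le_self: "1 \<le> w \<Longrightarrow> \<bar>a / w\<bar> \<le> \<bar>a\<bar>" for a w :: real
  using mult_left_mono[of 1 w "\<bar>a\<bar>"] by (simp add: divide_le_eq)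

lemma abs_damp_le: "0 \<le> e \<Longrightarrow> \<bar>damp e g x\<bar> \<le> \<bar>g x\<bar>"
  unfolding damp_def by (intro abs_divide_le_self damp_denominator_ge_1)

lemma damp_tendsto:
  assumes "e \<longlonglongrightarrow> 0"
  shows "(\<lambda>n. damp (e n) g x) \<longlonglongrightarrow> g x"
proof -
  have "(\<lambda>n. g x / (1 + e n * x\<^sup>2)) \<longlonglongrightarrow> g x / (1 + 0 * x\<^sup>2)"
    by (intro tendsto_intros assms) simp
  then show ?thesis unfolding damp_def by simp
qed

lemma quadratic_growth:
  "1 + \<bar>x\<bar> \<le> 2 * (1 + x\<^sup>2)" "\<bar>x\<bar> * (1 + \<bar>x\<bar>) \<le> 2 * (1 + x\<^sup>2)" "\<bar>x\<bar> \<le> 1 + x\<^sup>2" for x :: real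
proof -
  have "0 \<le> (\<bar>x\<bar> - 1)\<^sup>2" by simp
  then have "2 * \<bar>x\<bar> \<le> 1 + x\<^sup>2" unfolding power2_diff power2_abs by simp
  moreover have "\<bar>x\<bar> * (1 + \<bar>x\<bar>) = \<bar>x\<bar> + x\<^sup>2" by (simp add: distrib_left power2_eq_square)
  ultimately show "1 + \<bar>x\<bar> \<le> 2 * (1 + x\<^sup>2)" "\<bar>x\<bar> * (1 + \<bar>x\<bar>) \<le> 2 * (1 + x\<^sup>2)" "\<bar>x\<bar> \<le> 1 + x\<^sup>2"
    by (simp_all add: distrib_left) (use zero_le_power2[of x] in linarith)+
qed

lemma abs_damp_bounded:
  assumes e: "0 < e" "e \<le> 1" and g: "\<bar>g x\<bar> \<le> C * (1 + \<bar>x\<bar>)"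
  shows "\<bar>damp e g x\<bar> \<le> 2 * C / e"
proof -
  have w: "0 < 1 + e * x\<^sup>2" using e by (intro add_pos_nonneg) auto
  have C: "0 \<le> C" using order_trans[OF abs_ge_zero g] by (simp add: zero_le_mult_iff) linarith
  have "e * \<bar>g x\<bar> \<le> e * (C * (2 * (1 + x\<^sup>2)))"
    using e C order_trans[OF g mult_left_mono[OF quadratic_growth(1) C]] by (intro mult_left_mono) auto
  also have "\<dots> = 2 * C * (e * (1 + x\<^sup>2))" by simp
  also have "\<dots> \<le> 2 * C * (1 + e * x\<^sup>2)"
    using e C by (intro mult_left_mono) (auto simp: distrib_left)
  finally show ?thesis
    using e w unfolding damp_def by (simp add: abs_divide field_simps)
qed

definition damp_deriv :: "real \<Rightarrow> (real \<Rightarrow> real) \<Rightarrow> (real \<Rightarrow> real) \<Rightarrow> real \<Rightarrow> real" where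
  "damp_deriv e g g' x = g' x / (1 + e * x\<^sup>2) - e * (2 * x * g x) / (1 + e * x\<^sup>2)\<^sup>2"

lemma DERIV_damp:
  assumes e: "0 \<le> e" and g: "(g has_real_derivative g' x) (at x)"
  shows "(damp e g has_real_derivative damp_deriv e g g' x) (at x)"
proof -
  have w: "1 + e * x\<^sup>2 \<noteq> 0" using damp_denominator_ge_1[OF e, of x] by linarith
  have quot: "(u * w - v) / (w * w) = u / w - v / w\<^sup>2" if "w \<noteq> 0" for u v w :: real
    using that by (simp add: diff_divide_distrib power2_eq_square)
  have "((\<lambda>x. 1 + e * x\<^sup>2) has_real_derivative e * (2 * x)) (at x)"
    by (auto intro!: derivative_eq_intros)
  from DERIV_divide[OF g this w]
  have "((\<lambda>x. g x / (1 + e * x\<^sup>2)) has_real_derivative damp_deriv e g g' x) (at x)"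
    unfolding damp_deriv_def quot[OF w] by (simp add: mult.commute mult.left_commute)
  then show ?thesis unfolding damp_def[abs_def] .
qed

text \<open>Both denominators are at least 1 and \<open>e\<close> is at most 1, so the bound is
  uniform in \<open>e\<close>. The price is a factor \<open>x\<close>, which makes linear growth
  quadratic.\<close>

lemma abs_damp_deriv_le:
  assumes e: "0 \<le> e" "e \<le> 1"
  shows "\<bar>damp_deriv e g g' x\<bar> \<le> \<bar>g' x\<bar> + 2 * \<bar>x\<bar> * \<bar>g x\<bar>"
proof -
  have w: "1 \<le> 1 + e * x\<^sup>2" by (rule damp_denominator_ge_1[OF e(1)])
  have "\<bar>damp_deriv e g g' x\<bar> \<le> \<bar>g' x / (1 + e * x\<^sup>2)\<bar> + \<bar>e * (2 * x * g x) / (1 + e * x\<^sup>2)\<^sup>2\<bar>"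
    unfolding damp_deriv_def by (rule abs_triangle_ineq4)
  also have "\<dots> \<le> \<bar>g' x\<bar> + \<bar>e * (2 * x * g x)\<bar>"
    by (intro add_mono abs_divide_le_self w one_le_power)
  also have "\<bar>e * (2 * x * g x)\<bar> \<le> 1 * \<bar>2 * x * g x\<bar>"
    unfolding abs_mult[of e] using e by (intro mult_right_mono) auto
  finally show ?thesis by (simp add: abs_mult)
qed

lemma damp_deriv_tendsto:
  assumes "e \<longlonglongrightarrow> 0"
  shows "(\<lambda>n. damp_deriv (e n) g g' x) \<longlonglongrightarrow> g' x"
proof -
  have "(\<lambda>n. damp_deriv (e n) g g' x) \<longlonglongrightarrow> g' x / (1 + 0 * x\<^sup>2) - 0 * (2 * x * g x) / (1 + 0 * x\<^sup>2)\<^sup>2"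
    unfolding damp_deriv_def by (intro tendsto_intros assms) simp_all
  then show ?thesis by simp
qed

lemma damp_C1:
  assumes e: "0 \<le> e" and g: "\<And>x. (g has_real_derivative g' x) (at x)" and g': "continuous_on UNIV g'"
  shows "damp e g C1_differentiable_on UNIV"
proof -
  have w: "1 + e * x\<^sup>2 \<noteq> 0" for x :: real using damp_denominator_ge_1[OF e, of x] by linarith
  have "continuous_on UNIV g"
    using g by (meson DERIV_isCont continuous_at_imp_continuous_on)
  then have "continuous_on UNIV (damp_deriv e g g')"
    unfolding damp_deriv_def[abs_def] using g' w by (intro continuous_intros) auto
  moreover have "(damp e g has_vector_derivative damp_deriv e g g' x) (at x)" for x
    using DERIV_damp[of e g g' x] e g by (simp add: has_real_derivative_iff_has_vector_derivative)
  ultimately show ?thesis unfolding C1_differentiable_on_def by blast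
qed

section \<open>The resolvent identity for functions of linear growth\<close>

context normal_process
begin

text \<open>\<open>J\<close> abstracts the jump kernel, so that both processes share the argument.
  The derivative assumption is the resolvent equation solved for \<open>g'\<close>; the last two
  assumptions let the jump term of the damped functions pass to the limit under a bound uniform in
  \<open>e\<close>.\<close>

lemma resolvent_correlation:
  fixes J :: "(real \<Rightarrow> real) \<Rightarrow> real \<Rightarrow> real"
  assumes gen: "has_extended_generator M X (\<lambda>f x. deriv f x + max x 0 * (J f x - f x))"
    and rho: "0 < \<rho>"
    and g: "\<And>x. (g has_real_derivative \<rho> * g x - x - max x 0 * (J g x - g x)) (at x)"
    and J_cont: "continuous_on UNIV (J g)"
    and g_le: "\<And>x. \<bar>g x\<bar> \<le> C * (1 + \<bar>x\<bar>)"
    and J_le: "\<And>e x. 0 < e \<Longrightarrow> e \<le> 1 \<Longrightarrow> \<bar>J (damp e g) x\<bar> \<le> C * (1 + \<bar>x\<bar>)"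
    and J_lim: "\<And>e x. (\<And>n. 0 < e n \<and> e n \<le> 1) \<Longrightarrow> e \<longlonglongrightarrow> 0 \<Longrightarrow> (\<lambda>n. J (damp (e n) g) x) \<longlonglongrightarrow> J g x"
  shows "(LBINT t:{0..}. exp (- \<rho> * t) * (\<integral>\<omega>. X 0 \<omega> * X t \<omega> \<partial>M)) = (\<integral>\<omega>. X 0 \<omega> * g (X 0 \<omega>) \<partial>M)"
proof -
  define e where "e n = inverse (real (Suc n))" for n
  have e: "0 < e n \<and> e n \<le> 1" for n unfolding e_def by (simp add: inverse_le_1_iff)
  then have e': "0 < e n" "0 \<le> e n" "e n \<le> 1" for n using less_imp_le[of 0 "e n"] by auto
  have e0: "e \<longlonglongrightarrow> 0" unfolding e_def[abs_def] by (rule LIMSEQ_inverse_real_of_nat)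
  define g' where "g' x = \<rho> * g x - x - max x 0 * (J g x - g x)" for x
  have C: "0 \<le> C" using g_le[of 0] by simp
  have Jg_le: "\<bar>J g x\<bar> \<le> C * (1 + \<bar>x\<bar>)" for x
    by (rule LIMSEQ_le_const2[OF tendsto_rabs[OF J_lim[OF e e0]]]) (use J_le e' in auto)
  have jump: "\<bar>max x 0 * (u - v)\<bar> \<le> 4 * C * (1 + x\<^sup>2)"
    if "\<bar>u\<bar> \<le> C * (1 + \<bar>x\<bar>)" "\<bar>v\<bar> \<le> C * (1 + \<bar>x\<bar>)" for u v x
  proof -
    have "\<bar>max x 0 * (u - v)\<bar> \<le> \<bar>x\<bar> * (2 * (C * (1 + \<bar>x\<bar>)))"
      unfolding abs_mult using that by (intro mult_mono) auto
    also have "\<dots> = 2 * C * (\<bar>x\<bar> * (1 + \<bar>x\<bar>))" by simp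
    also have "\<dots> \<le> 2 * C * (2 * (1 + x\<^sup>2))"
      using C by (intro mult_left_mono quadratic_growth) auto
    finally show ?thesis by (simp add: algebra_simps)
  qed
  have gq: "\<bar>g x\<bar> \<le> 2 * C * (1 + x\<^sup>2)" for x
    using order_trans[OF g_le mult_left_mono[OF quadratic_growth(1) C]] by (simp add: mult.assoc mult.left_commute)
  have g'_le: "\<bar>g' x\<bar> \<le> (2 * \<rho> * C + 1 + 4 * C) * (1 + x\<^sup>2)" for x
  proof -
    have "\<bar>\<rho> * g x\<bar> \<le> \<rho> * (2 * C * (1 + x\<^sup>2))"
      unfolding abs_mult using rho gq[of x] by (auto intro!: mult_left_mono)
    with jump[OF Jg_le g_le, of x] quadratic_growth(3)[of x]
    show ?thesis unfolding g'_def distrib_right by (simp add: algebra_simps)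
  qed
  have xg: "2 * \<bar>x\<bar> * \<bar>g x\<bar> \<le> 4 * C * (1 + x\<^sup>2)" for x
  proof -
    have "2 * \<bar>x\<bar> * \<bar>g x\<bar> \<le> 2 * \<bar>x\<bar> * (C * (1 + \<bar>x\<bar>))"
      by (intro mult_left_mono g_le) auto
    also have "\<dots> = 2 * C * (\<bar>x\<bar> * (1 + \<bar>x\<bar>))" by simp
    also have "\<dots> \<le> 2 * C * (2 * (1 + x\<^sup>2))"
      using C by (intro mult_left_mono quadratic_growth) auto
    finally show ?thesis by (simp add: algebra_simps)
  qed
  define f where "f n = damp (e n) g" for n
  define h where "h n x = damp_deriv (e n) g g' x + max x 0 * (J (f n) x - f n x)" for n x
  \<comment> \<open>The coefficient 12 collects three times \<open>4 * C\<close>: the jump part of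
    \<open>g'\<close>, the derivative of the damping factor, and the jump part of
    \<open>h n\<close>.\<close>
  define D where "D = 2 * \<rho> * C + 1 + 12 * C"
  have g1: "(g has_real_derivative g' x) (at x)" for x unfolding g'_def by (rule g)
  have "continuous_on UNIV g"
    using g1 by (meson DERIV_isCont continuous_at_imp_continuous_on)
  then have g'_cont: "continuous_on UNIV g'"
    unfolding g'_def[abs_def] using J_cont by (intro continuous_intros)
  have f_g: "\<bar>f n x\<bar> \<le> \<bar>g x\<bar>" for n x unfolding f_def by (rule abs_damp_le[OF e'(2)])
  have f_bd: "\<bar>f n x\<bar> \<le> 2 * C / e n" for n x
    unfolding f_def by (rule abs_damp_bounded[OF e'(1,3) g_le])
  have deriv_f: "deriv (f n) x = damp_deriv (e n) g g' x" for n x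
    unfolding f_def by (rule DERIV_imp_deriv, rule DERIV_damp[OF e'(2) g1])
  have lim: "(LBINT t:{0..}. exp (- \<rho> * t) * (\<integral>\<omega>. X 0 \<omega> * (\<lambda>x. x) (X t \<omega>) \<partial>M)) =
      (\<integral>\<omega>. X 0 \<omega> * g (X 0 \<omega>) \<partial>M)"
  proof (rule correlation_resolvent_limit[OF rho, where f=f and h=h and C=D])
    fix n x
    have "f n C1_differentiable_on UNIV"
      unfolding f_def by (rule damp_C1[OF e'(2) g1 g'_cont])
    moreover have "bounded (range (f n))"
      unfolding bounded_iff using f_bd by auto
    ultimately have "extended_generator M X (f n) (\<lambda>x. deriv (f n) x + max x 0 * (J (f n) x - f n x))"
      using gen unfolding has_extended_generator_def by simp
    also have "(\<lambda>x. deriv (f n) x + max x 0 * (J (f n) x - f n x)) = h n"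
      unfolding h_def deriv_f by simp
    finally show "extended_generator M X (f n) (h n)" .
    show "\<bar>f n x\<bar> \<le> 2 * C / e n" by (rule f_bd)
    have "2 * C * (1 + x\<^sup>2) \<le> D * (1 + x\<^sup>2)"
      unfolding D_def using C rho by (intro mult_right_mono) auto
    then show "\<bar>f n x\<bar> \<le> D * (1 + x\<^sup>2)" using f_g[of n x] gq[of x] by linarith
    have "\<bar>damp_deriv (e n) g g' x\<bar> \<le> (2 * \<rho> * C + 1 + 4 * C) * (1 + x\<^sup>2) + 4 * C * (1 + x\<^sup>2)"
      by (rule order_trans[OF abs_damp_deriv_le[OF e'(2,3)]]) (rule add_mono[OF g'_le xg])
    moreover have "\<bar>max x 0 * (J (f n) x - f n x)\<bar> \<le> 4 * C * (1 + x\<^sup>2)"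
      unfolding f_def
      by (rule jump[OF J_le[OF e'(1,3)] order_trans[OF abs_damp_le[OF e'(2), of _ g x] g_le[of x]]])
    ultimately have "\<bar>h n x\<bar> \<le> (2 * \<rho> * C + 1 + 4 * C) * (1 + x\<^sup>2) + 4 * C * (1 + x\<^sup>2) + 4 * C * (1 + x\<^sup>2)"
      unfolding h_def by linarith
    then show "\<bar>h n x\<bar> \<le> D * (1 + x\<^sup>2)" unfolding D_def by (simp add: algebra_simps)
    show fl: "(\<lambda>n. f n x) \<longlonglongrightarrow> g x" unfolding f_def by (rule damp_tendsto[OF e0])
    have "(\<lambda>n. \<rho> * f n x - h n x) \<longlonglongrightarrow> \<rho> * g x - (g' x + max x 0 * (J g x - g x))"
      unfolding h_def using J_lim[OF e e0, of x] fl
      by (intro tendsto_intros damp_deriv_tendsto[OF e0]) (simp_all add: f_def)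
    then show "(\<lambda>n. \<rho> * f n x - h n x) \<longlonglongrightarrow> x" unfolding g'_def by simp
  qed
  then show ?thesis .
qed

text \<open>Reflecting the negative half line changes the sign of the factor \<open>x\<close>, hence
  \<open>A - B\<close>.\<close>

lemma expectation_X0_mult:
  assumes [measurable]: "g \<in> borel_measurable borel"
    and A: "has_bochner_integral lborel (\<lambda>x. indicator {0..} x * (x * g x * exp (- x\<^sup>2 / 2))) A"
    and B: "has_bochner_integral lborel (\<lambda>x. indicator {0..} x * (x * g (- x) * exp (- x\<^sup>2 / 2))) B"
  shows "(\<integral>\<omega>. X 0 \<omega> * g (X 0 \<omega>) \<partial>M) = (A - B) / sqrt (2 * pi)"
proof -
  have "has_bochner_integral lborel (\<lambda>x. indicator {0..} x * (- x * g (- x) * exp (- (- x)\<^sup>2 / 2))) (- B)"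
    using has_bochner_integral_minus[OF B] by simp
  from has_bochner_integral_halves[OF A this]
  have "has_bochner_integral lborel (\<lambda>x. x * g x * exp (- x\<^sup>2 / 2)) (A - B)" by simp
  then have "has_bochner_integral lborel (\<lambda>x. x * g x * exp (- x\<^sup>2 / 2) / sqrt (2 * pi)) ((A - B) / sqrt (2 * pi))"
    by (rule has_bochner_integral_divide)
  then have "(\<integral>x. std_normal_density x * (x * g x) \<partial>lborel) = (A - B) / sqrt (2 * pi)"
    by (auto simp: has_bochner_integral_iff std_normal_density_def mult.commute mult.left_commute)
  then show ?thesis
    using distributed_integral[OF X_normal[OF order_refl], of "\<lambda>x. x * g x"] by simp
qed

end

text \<open>The Rayleigh density is the weight of the half-line integrals. The mean of
  \<open>g\<close> after a forward jump is therefore the same integral as the negative half of the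
  expectation of \<open>X 0 * g (X 0)\<close>.\<close>

lemma rayleigh_integral:
  assumes [measurable]: "f \<in> borel_measurable borel"
    and B: "has_bochner_integral lborel (\<lambda>x. indicator {0..} x * (x * f x * exp (- x\<^sup>2 / 2))) B"
  shows "has_bochner_integral rayleigh f B"
proof -
  have eq: "(\<lambda>x. (if 0 < x then x * exp (- x\<^sup>2 / 2) else 0) *\<^sub>R f x) =
      (\<lambda>x. indicator {0..} x * (x * f x * exp (- x\<^sup>2 / 2)))"
    by (auto simp: fun_eq_iff split: split_indicator)
  show ?thesis
    unfolding rayleigh_def
    by (rule has_bochner_integral_density) (use B in \<open>auto simp: eq simp del: real_scaleR_def\<close>)
qed

lemma affine_exp_half_integral:
  assumes "0 < \<rho>"
  shows "has_bochner_integral lborel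
    (\<lambda>x. indicator {0..} x * (x * (a * x + b + K * exp (- \<rho> * x)) * exp (- x\<^sup>2 / 2)))
    (a * sqrt (pi / 2) + b + K * (1 - Omega \<rho>))"
proof -
  have "has_bochner_integral lborel
    (\<lambda>x. a * (indicator {0..} x * (x\<^sup>2 * exp (- x\<^sup>2 / 2))) + b * (indicator {0..} x * (x * exp (- x\<^sup>2 / 2)))
      + K * (indicator {0..} x * (x * exp (- \<rho> * x) * exp (- x\<^sup>2 / 2))))
    (a * sqrt (pi / 2) + b * 1 + K * (1 - Omega \<rho>))"
    by (intro has_bochner_integral_add has_bochner_integral_mult_right
        has_bochner_integral_gauss_mean has_bochner_integral_gauss_second_moment
        has_bochner_integral_exp_gauss_mean assms)
  moreover have "(\<lambda>x. a * (indicator {0..} x * (x\<^sup>2 * exp (- x\<^sup>2 / 2))) + b * (indicator {0..} x * (x * exp (- x\<^sup>2 / 2)))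
      + K * (indicator {0..} x * (x * exp (- \<rho> * x) * exp (- x\<^sup>2 / 2)))) =
    (\<lambda>x. indicator {0..} x * (x * (a * x + b + K * exp (- \<rho> * x)) * exp (- x\<^sup>2 / 2)) :: real)"
    by (simp add: fun_eq_iff algebra_simps power2_eq_square)
  ultimately show ?thesis by simp
qed

section \<open>The two explicit resolvents\<close>

text \<open>The solutions of \<open>g' = \<rho> g - x\<close>, the resolvent equation where no jumps occur.\<close>

definition flow_branch :: "real \<Rightarrow> real \<Rightarrow> real \<Rightarrow> real" where
  "flow_branch \<rho> K x = x / \<rho> + 1 / \<rho>\<^sup>2 + K * exp (\<rho> * x)"

lemma abs_exp_nonpos_le: "0 < \<rho> \<Longrightarrow> x \<le> 0 \<Longrightarrow> \<bar>K * exp (\<rho> * x)\<bar> \<le> \<bar>K\<bar>" for x K \<rho> :: real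
  unfolding abs_mult by (rule mult_right_le_one_le) (auto simp: mult_nonneg_nonpos)

lemma abs_flow_branch_le:
  assumes "0 < \<rho>" "x \<le> 0"
  shows "\<bar>flow_branch \<rho> K x\<bar> \<le> (1 / \<rho> + 1 / \<rho>\<^sup>2 + \<bar>K\<bar>) * (1 + \<bar>x\<bar>)"
proof -
  have "\<bar>flow_branch \<rho> K x\<bar> \<le> \<bar>x / \<rho>\<bar> + \<bar>1 / \<rho>\<^sup>2\<bar> + \<bar>K * exp (\<rho> * x)\<bar>"
    unfolding flow_branch_def by linarith
  also have "\<dots> \<le> \<bar>x\<bar> * (1 / \<rho>) + 1 / \<rho>\<^sup>2 + \<bar>K\<bar>"
    using abs_exp_nonpos_le[OF assms] assms by (simp add: abs_divide)
  also have "\<dots> \<le> (1 / \<rho> + 1 / \<rho>\<^sup>2 + \<bar>K\<bar>) * (1 + \<bar>x\<bar>)"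
  proof -
    have "0 \<le> 1 / \<rho> + (1 / \<rho>\<^sup>2 + \<bar>K\<bar>) * \<bar>x\<bar>" using assms(1) by simp
    moreover have "(u + v + w) * (1 + y) = y * u + v + w + (u + (v + w) * y)" for u v w y :: real
      by (simp add: algebra_simps)
    ultimately show ?thesis by simp
  qed
  finally show ?thesis .
qed

lemma DERIV_flow_branch:
  "0 < \<rho> \<Longrightarrow> (flow_branch \<rho> K has_real_derivative \<rho> * flow_branch \<rho> K x - x) (at x)"
  unfolding flow_branch_def[abs_def]
  by (auto intro!: derivative_eq_intros simp: field_simps power2_eq_square)

text \<open>The jump rate vanishes at 0, so both equations prescribe the slope
  \<open>\<rho> * g 0\<close> there. Matching the values alone already makes the slopes
  match.\<close>

lemma DERIV_resolvent_glue:
  assumes rho: "0 < \<rho>"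
    and r: "\<And>x. (r has_real_derivative \<rho> * r x - x - x * (J x - r x)) (at x)"
    and r0: "r 0 = flow_branch \<rho> K 0"
  defines "g \<equiv> \<lambda>x. if x \<le> 0 then flow_branch \<rho> K x else r x"
  shows "(g has_real_derivative \<rho> * g x - x - max x 0 * (J x - g x)) (at x)"
proof -
  have "(g has_real_derivative (if x \<le> 0 then \<rho> * flow_branch \<rho> K x - x
      else \<rho> * r x - x - x * (J x - r x))) (at x)"
    unfolding g_def by (rule DERIV_glue[OF DERIV_flow_branch[OF rho] r]) (simp_all add: r0)
  moreover have "(if x \<le> 0 then \<rho> * flow_branch \<rho> K x - x else \<rho> * r x - x - x * (J x - r x))
      = \<rho> * g x - x - max x 0 * (J x - g x)"
    by (simp add: g_def)
  ultimately show ?thesis by simp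
qed

lemma sqrt_pi_constants:
  "sqrt (2 * pi) = 2 * sqrt (pi / 2)" "sqrt (8 / pi) = 2 / sqrt (pi / 2)" "sqrt (32 / pi) = 4 / sqrt (pi / 2)"
proof -
  have "2 * pi = 2\<^sup>2 * (pi / 2)" "8 / pi = 2\<^sup>2 / (pi / 2)" "32 / pi = 4\<^sup>2 / (pi / 2)" by simp_all
  then show "sqrt (2 * pi) = 2 * sqrt (pi / 2)" "sqrt (8 / pi) = 2 / sqrt (pi / 2)" "sqrt (32 / pi) = 4 / sqrt (pi / 2)"
    by (simp_all only: real_sqrt_mult real_sqrt_divide real_sqrt_abs abs_numeral)
qed

section \<open>The forward process\<close>

lemma sigma_sq_F:
  assumes F: "stationary_pdmp gen_F M R" and rho: "0 < \<rho>"
  shows "sigma_sq M R \<rho> = sqrt (32 / pi) *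
             (1 - (\<rho>\<^sup>2 - \<rho> * sqrt (pi / 2) + Omega \<rho>)\<^sup>2 /
                  (\<rho> ^ 4 * Omega \<rho> * (2 - Omega \<rho>)))"
proof -
  obtain Y where "normal_process M R Y" using stationary_pdmp_normal_process[OF F] by blast
  then interpret normal_process M R Y .
  define s where "s = sqrt (pi / 2)"
  define W where "W = Omega \<rho>"
  have s: "0 < s" unfolding s_def by simp
  have W: "0 < W" "W \<le> 1" unfolding W_def using Omega_pos[OF rho] Omega_le_1[OF rho] by auto
  \<comment> \<open>\<open>A - 1\<close> is the mean of \<open>g\<close> under the jump kernel; that mean depends on \<open>K\<close>, which in turn is
    determined by \<open>A\<close> through continuity at 0. This fixed-point equation gives \<open>A\<close>.\<close>
  define A where "A = (\<rho>\<^sup>2 - \<rho> * s + W) / (\<rho>\<^sup>2 * W * (2 - W))"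
  define K where "K = A * (1 - W) - 1 / \<rho>\<^sup>2"
  \<comment> \<open>With constant jump mean \<open>A - 1\<close> the equation is
    \<open>r' = (\<rho> + x) r - A x\<close>, and this is its bounded solution.\<close>
  define r where "r x = A * (1 - \<rho> * mills (\<rho> + x))" for x
  define g where "g x = (if x \<le> 0 then flow_branch \<rho> K x else r x)" for x
  define J where "J f x = (\<integral>y. f (- y) \<partial>rayleigh)" for f :: "real \<Rightarrow> real" and x :: real
  have A_eq: "A * (W * (2 - W)) = 1 - s / \<rho> + W / \<rho>\<^sup>2"
  proof -
    have "A * (W * (2 - W)) = (\<rho>\<^sup>2 - \<rho> * s + W) / \<rho>\<^sup>2"
      unfolding A_def using W rho by simp
    also have "\<dots> = 1 - s / \<rho> + W / \<rho>\<^sup>2"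
      using rho by (simp add: field_simps power2_eq_square)
    finally show ?thesis .
  qed
  \<comment> \<open>\<open>A\<close> enters the mean through \<open>K\<close> as
    \<open>A * (1 - W)^2\<close>; moving it to the other side of the fixed-point equation leaves the
    factor \<open>1 - (1 - W)^2 = W * (2 - W)\<close>.\<close>
  have "A * (1 - W) * (1 - W) = A - A * (W * (2 - W))" by (simp add: algebra_simps)
  then have mean: "- s / \<rho> + 1 / \<rho>\<^sup>2 + K * (1 - W) = A - 1"
    unfolding A_eq unfolding K_def left_diff_distrib by (simp add: right_diff_distrib)
  have r0: "r 0 = flow_branch \<rho> K 0"
    unfolding r_def flow_branch_def K_def W_def Omega_eq_mills by simp
  have "(r has_real_derivative A * (0 - \<rho> * ((\<rho> + x) * mills (\<rho> + x) - 1))) (at x)" for x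
    unfolding r_def[abs_def] by (auto intro!: derivative_eq_intros)
  then have rd: "(r has_real_derivative \<rho> * r x - x - x * ((A - 1) - r x)) (at x)" for x
    by (rule DERIV_cong) (simp add: r_def algebra_simps)
  have gd: "(g has_real_derivative \<rho> * g x - x - max x 0 * ((A - 1) - g x)) (at x)" for x
    unfolding g_def[abs_def] by (rule DERIV_resolvent_glue[OF rho rd r0])
  have "continuous_on UNIV g"
    using gd by (meson DERIV_isCont continuous_at_imp_continuous_on)
  then have [measurable]: "g \<in> borel_measurable borel" by (rule borel_measurable_continuous_onI)
  have neg: "(\<lambda>x. indicator {0..} x * (x * (- 1 / \<rho> * x + 1 / \<rho>\<^sup>2 + K * exp (- \<rho> * x)) * exp (- x\<^sup>2 / 2))) =
      (\<lambda>x. indicator {0..} x * (x * g (- x) * exp (- x\<^sup>2 / 2)))"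
    by (auto simp: fun_eq_iff g_def flow_branch_def split: split_indicator)
  have hn: "has_bochner_integral lborel (\<lambda>x. indicator {0..} x * (x * g (- x) * exp (- x\<^sup>2 / 2))) (A - 1)"
    using affine_exp_half_integral[OF rho, of "- 1 / \<rho>" "1 / \<rho>\<^sup>2" K]
    unfolding neg using mean by (simp add: s_def W_def)
  have Jg: "J g x = A - 1" for x
    unfolding J_def by (rule has_bochner_integral_integral_eq[OF rayleigh_integral[OF _ hn]]) measurable
  define C where "C = 1 / \<rho> + 1 / \<rho>\<^sup>2 + \<bar>K\<bar> + 2 * \<bar>A\<bar>"
  have C: "0 \<le> C" unfolding C_def using rho by simp
  have g_le: "\<bar>g x\<bar> \<le> C * (1 + \<bar>x\<bar>)" for x
  proof (cases "x \<le> 0")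
    case True
    then have "\<bar>g x\<bar> \<le> (1 / \<rho> + 1 / \<rho>\<^sup>2 + \<bar>K\<bar>) * (1 + \<bar>x\<bar>)"
      using abs_flow_branch_le[OF rho] by (simp add: g_def)
    also have "\<dots> \<le> C * (1 + \<bar>x\<bar>)" unfolding C_def by (intro mult_right_mono) auto
    finally show ?thesis .
  next
    case False
    have "\<bar>1 - \<rho> * mills (\<rho> + x)\<bar> \<le> 1 + \<rho> * \<bar>mills (\<rho> + x)\<bar>"
      using rho abs_triangle_ineq4[of 1 "\<rho> * mills (\<rho> + x)"] by (simp add: abs_mult)
    also have "\<dots> \<le> 1 + \<rho> * (1 / \<rho>)"
      using False rho by (intro add_left_mono mult_left_mono abs_mills_shift_le) auto
    also have "\<dots> = 2" using rho by simp
    finally have "\<bar>r x\<bar> \<le> \<bar>A\<bar> * 2" unfolding r_def abs_mult by (intro mult_left_mono) auto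
    also have "\<dots> \<le> C * 1" unfolding C_def using rho by simp
    also have "\<dots> \<le> C * (1 + \<bar>x\<bar>)" using C by (intro mult_left_mono) auto
    finally show ?thesis using False by (simp add: g_def)
  qed
  \<comment> \<open>One bound for the jump means of all damped versions of \<open>g\<close>,
    independent of the position before the jump.\<close>
  define V where "V = (\<integral>y. C * (1 + \<bar>- y\<bar>) \<partial>rayleigh)"
  have Vint: "integrable rayleigh (\<lambda>y. C * (1 + \<bar>- y\<bar>))"
  proof -
    have "(\<lambda>x. indicator {0..} x * (x * (1 * x + 1 + 0 * exp (- \<rho> * x)) * exp (- x\<^sup>2 / 2))) =
      (\<lambda>x. indicator {0..} x * (x * (1 + \<bar>- x\<bar>) * exp (- x\<^sup>2 / 2)) :: real)"
      by (auto simp: fun_eq_iff split: split_indicator)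
    with affine_exp_half_integral[OF rho, of 1 1 0]
    have "has_bochner_integral rayleigh (\<lambda>y. 1 + \<bar>- y\<bar>) (sqrt (pi / 2) + 1)"
      by (intro rayleigh_integral) simp_all
    then show ?thesis by (intro integrable_mult_right) (auto simp: has_bochner_integral_iff)
  qed
  have [measurable]: "damp e g \<in> borel_measurable borel" for e
    unfolding damp_def[abs_def] by measurable
  have rs [measurable_cong]: "sets rayleigh = sets borel" by (simp add: rayleigh_def)
  have damp_le: "\<bar>damp e g (- y)\<bar> \<le> C * (1 + \<bar>- y\<bar>)" if "0 \<le> e" for e y
    by (rule order_trans[OF abs_damp_le[OF that]]) (rule g_le)
  have V0: "0 \<le> V" unfolding V_def using C by (intro integral_nonneg_AE) auto
  have corr: "(LBINT t:{0..}. exp (- \<rho> * t) * (\<integral>\<omega>. R 0 \<omega> * R t \<omega> \<partial>M)) = (\<integral>\<omega>. R 0 \<omega> * g (R 0 \<omega>) \<partial>M)"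
  proof (rule resolvent_correlation[where J=J and C="C + V", OF _ rho])
    have "gen_F = (\<lambda>f x. deriv f x + max x 0 * (J f x - f x))"
      by (simp add: fun_eq_iff gen_F_def J_def)
    then show "has_extended_generator M R (\<lambda>f x. deriv f x + max x 0 * (J f x - f x))"
      using F unfolding stationary_pdmp_def by simp
    show "(g has_real_derivative \<rho> * g x - x - max x 0 * (J g x - g x)) (at x)" for x
      unfolding Jg by (rule gd)
    show "continuous_on UNIV (J g)" using Jg by (simp add: continuous_on_const cong: continuous_on_cong)
    show "\<bar>g x\<bar> \<le> (C + V) * (1 + \<bar>x\<bar>)" for x
      by (rule order_trans[OF g_le]) (use V0 in \<open>auto intro!: mult_right_mono\<close>)
    show "\<bar>J (damp e g) x\<bar> \<le> (C + V) * (1 + \<bar>x\<bar>)" if "0 < e" "e \<le> 1" for e x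
    proof -
      have "\<bar>J (damp e g) x\<bar> \<le> (\<integral>y. \<bar>damp e g (- y)\<bar> \<partial>rayleigh)"
        unfolding J_def by (rule integral_abs_bound)
      also have "\<dots> \<le> V"
        unfolding V_def
      proof (rule integral_mono[OF _ Vint])
        show "integrable rayleigh (\<lambda>y. \<bar>damp e g (- y)\<bar>)"
          by (rule Bochner_Integration.integrable_bound[OF Vint], measurable)
             (rule AE_I2, use damp_le[of e] that C in \<open>simp\<close>)
      qed (use damp_le that in auto)
      also have "\<dots> \<le> (C + V) * 1" using C by simp
      also have "\<dots> \<le> (C + V) * (1 + \<bar>x\<bar>)" using C V0 by (intro mult_left_mono) auto
      finally show ?thesis .
    qed
    show "(\<lambda>n. J (damp (e n) g) x) \<longlonglongrightarrow> J g x" if e: "\<And>n. 0 < e n \<and> e n \<le> 1" "e \<longlonglongrightarrow> 0" for e x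
      unfolding J_def
    proof (rule integral_dominated_convergence[OF _ _ Vint])
      show "AE y in rayleigh. norm (damp (e n) g (- y)) \<le> C * (1 + \<bar>- y\<bar>)" for n
        unfolding real_norm_def using e(1)[of n] by (intro AE_I2 damp_le) simp
      show "AE y in rayleigh. (\<lambda>n. damp (e n) g (- y)) \<longlonglongrightarrow> g (- y)"
        by (intro AE_I2 damp_tendsto e)
    qed measurable
  qed
  have "has_bochner_integral lborel (\<lambda>x. A * (indicator {0..} x * (x * exp (- x\<^sup>2 / 2)))
      - (A * \<rho>) * (indicator {0..} x * (x * mills (\<rho> + x) * exp (- x\<^sup>2 / 2))))
      (A * 1 - (A * \<rho>) * (mills \<rho> / \<rho>\<^sup>2 + 1 / \<rho> - sqrt (pi / 2) / \<rho>\<^sup>2))"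
    by (intro has_bochner_integral_diff has_bochner_integral_mult_right
        has_bochner_integral_gauss_mean has_bochner_integral_mills_gauss_mean rho)
  also have "(\<lambda>x. A * (indicator {0..} x * (x * exp (- x\<^sup>2 / 2)))
      - (A * \<rho>) * (indicator {0..} x * (x * mills (\<rho> + x) * exp (- x\<^sup>2 / 2)))) =
      (\<lambda>x. indicator {0..} x * (x * g x * exp (- x\<^sup>2 / 2)))"
    by (auto simp: fun_eq_iff g_def r_def algebra_simps split: split_indicator)
  also have "A * 1 - (A * \<rho>) * (mills \<rho> / \<rho>\<^sup>2 + 1 / \<rho> - sqrt (pi / 2) / \<rho>\<^sup>2) =
      A - A * (1 - s / \<rho> + W / \<rho>\<^sup>2)"
    unfolding W_def Omega_eq_mills s_def[symmetric] using rho by (simp add: field_simps power2_eq_square)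
  finally have hp: "has_bochner_integral lborel (\<lambda>x. indicator {0..} x * (x * g x * exp (- x\<^sup>2 / 2)))
      (A - A * (1 - s / \<rho> + W / \<rho>\<^sup>2))" .
  have "sigma_sq M R \<rho> = 8 * ((A - A * (1 - s / \<rho> + W / \<rho>\<^sup>2) - (A - 1)) / sqrt (2 * pi))"
    unfolding sigma_sq_def corr expectation_X0_mult[OF \<open>g \<in> borel_measurable borel\<close> hp hn] ..
  also have "\<dots> = 4 / s * (1 - A * (1 - s / \<rho> + W / \<rho>\<^sup>2))"
    unfolding sqrt_pi_constants s_def[symmetric] using s by (simp add: field_simps)
  \<comment> \<open>\<open>A\<close> has the numerator of this factor as its own numerator, which
    produces the square.\<close>
  also have "A * (1 - s / \<rho> + W / \<rho>\<^sup>2) = (\<rho>\<^sup>2 - \<rho> * s + W)\<^sup>2 / (\<rho> ^ 4 * W * (2 - W))"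
  proof -
    have "1 - s / \<rho> + W / \<rho>\<^sup>2 = (\<rho>\<^sup>2 - \<rho> * s + W) / \<rho>\<^sup>2"
      using rho by (simp add: field_simps power2_eq_square)
    then show ?thesis
      unfolding A_def by (simp add: power2_eq_square power4_eq_xxxx mult_ac)
  qed
  finally show ?thesis unfolding sqrt_pi_constants s_def W_def .
qed

section \<open>The bouncy process\<close>

lemma sigma_sq_B:
  assumes B: "stationary_pdmp gen_B M R" and rho: "0 < \<rho>"
  shows "sigma_sq M R \<rho> = 8 / \<rho> ^ 4 *
             (\<rho> ^ 3 - \<rho>\<^sup>2 * sqrt (8 / pi) + \<rho> -
              sqrt (8 / pi) * ((1 + \<rho>\<^sup>2) * Omega \<rho> - \<rho>\<^sup>2)\<^sup>2 / Omega (2 * \<rho>))"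
proof -
  obtain Y where "normal_process M R Y" using stationary_pdmp_normal_process[OF B] by blast
  then interpret normal_process M R Y .
  define s where "s = sqrt (pi / 2)"
  define W where "W = Omega \<rho>"
  define O2 where "O2 = Omega (2 * \<rho>)"
  have s: "0 < s" unfolding s_def by simp
  have O2: "0 < O2" unfolding O2_def using Omega_pos[of "2 * \<rho>"] rho by simp
  have mO: "mills \<rho> = W / \<rho>" and mO2: "mills (2 * \<rho>) = O2 / (2 * \<rho>)"
    unfolding W_def O2_def Omega_eq_mills using rho by simp_all
  \<comment> \<open>At \<open>K = 0\<close> the positive branch exceeds the negative one by
    \<open>- 2 * D / \<rho>^2\<close> at 0.\<close>
  define D where "D = (1 + \<rho>\<^sup>2) * W - \<rho>\<^sup>2"
  \<comment> \<open>the only value for which the two branches of \<open>g\<close> agree at 0\<close>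
  define K where "K = - 2 * D / (\<rho>\<^sup>2 * O2)"
  \<comment> \<open>This is the integral of \<open>(x + u) (1 + flow_branch \<rho> K (- (x + u)))
    exp (- (\<rho> + x) u - u^2 / 2)\<close> over \<open>u > 0\<close>. The affine part of the
    branch yields first and second moments in \<open>x + u\<close>, its exponential part the terms
    with \<open>K\<close>.\<close>
  define r where "r x = - x / \<rho> + (2 + 1 / \<rho>\<^sup>2) - (2 * \<rho> + 2 / \<rho>) * mills (\<rho> + x)
      + K * exp (- \<rho> * x) * (1 - 2 * \<rho> * mills (2 * \<rho> + x))" for x
  define g where "g x = (if x \<le> 0 then flow_branch \<rho> K x else r x)" for x
  define J where "J f x = f (- x)" for f :: "real \<Rightarrow> real" and x :: real
  have r0: "r 0 = flow_branch \<rho> K 0"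
  proof -
    have "K * O2 = 2 - (2 * \<rho> + 2 / \<rho>) * (W / \<rho>)"
      unfolding K_def D_def using rho O2 by (simp add: field_simps power2_eq_square)
    moreover have "r 0 = 2 + 1 / \<rho>\<^sup>2 - (2 * \<rho> + 2 / \<rho>) * (W / \<rho>) + K * (1 - O2)"
      unfolding r_def using rho by (simp add: mO mO2)
    ultimately show ?thesis unfolding flow_branch_def by (simp add: right_diff_distrib)
  qed
  have "(r has_real_derivative - 1 / \<rho> - (2 * \<rho> + 2 / \<rho>) * ((\<rho> + x) * mills (\<rho> + x) - 1) +
      (K * (exp (- \<rho> * x) * - \<rho>) * (1 - 2 * \<rho> * mills (2 * \<rho> + x)) +
       (0 - 2 * \<rho> * ((2 * \<rho> + x) * mills (2 * \<rho> + x) - 1)) * (K * exp (- \<rho> * x)))) (at x)" for x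
    unfolding r_def[abs_def] using rho by (auto intro!: derivative_eq_intros)
  then have rd: "(r has_real_derivative \<rho> * r x - x - x * (flow_branch \<rho> K (- x) - r x)) (at x)" for x
    by (rule DERIV_cong)
       (use rho in \<open>simp add: r_def flow_branch_def field_simps power2_eq_square\<close>)
  have gd0: "(g has_real_derivative \<rho> * g x - x - max x 0 * (flow_branch \<rho> K (- x) - g x)) (at x)" for x
    unfolding g_def[abs_def] by (rule DERIV_resolvent_glue[OF rho rd r0])
  \<comment> \<open>For \<open>x >= 0\<close> the point \<open>- x\<close> lies on the flow branch,
    and for \<open>x < 0\<close> the jump rate is 0.\<close>
  have gd: "(g has_real_derivative \<rho> * g x - x - max x 0 * (J g x - g x)) (at x)" for x
    using gd0[of x] by (cases "0 \<le> x") (auto simp: J_def g_def max_def)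
  have gc: "continuous_on UNIV g"
    using gd by (meson DERIV_isCont continuous_at_imp_continuous_on)
  then have [measurable]: "g \<in> borel_measurable borel" by (rule borel_measurable_continuous_onI)
  define C where "C = (1 / \<rho> + 1 / \<rho>\<^sup>2 + \<bar>K\<bar>) + (2 + (2 * \<rho> + 2 / \<rho>) * (1 / \<rho>) + \<bar>K\<bar>)"
  have C: "0 \<le> C" unfolding C_def using rho by simp
  have g_le: "\<bar>g x\<bar> \<le> C * (1 + \<bar>x\<bar>)" for x
  proof (cases "x \<le> 0")
    case True
    then have "\<bar>g x\<bar> \<le> (1 / \<rho> + 1 / \<rho>\<^sup>2 + \<bar>K\<bar>) * (1 + \<bar>x\<bar>)"
      using abs_flow_branch_le[OF rho] by (simp add: g_def)
    also have "\<dots> \<le> C * (1 + \<bar>x\<bar>)" unfolding C_def using rho by (intro mult_right_mono) auto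
    finally show ?thesis .
  next
    case False
    have 1: "\<bar>- x / \<rho> + (1 / \<rho>\<^sup>2) + K * exp (- \<rho> * x)\<bar> \<le> (1 / \<rho> + 1 / \<rho>\<^sup>2 + \<bar>K\<bar>) * (1 + \<bar>x\<bar>)"
      using abs_flow_branch_le[OF rho, of "- x" K] False unfolding flow_branch_def by simp
    have 2: "\<bar>(2 * \<rho> + 2 / \<rho>) * mills (\<rho> + x)\<bar> \<le> (2 * \<rho> + 2 / \<rho>) * (1 / \<rho>)"
      unfolding abs_mult using False rho abs_mills_shift_le[OF rho, of x]
      by (intro mult_mono) auto
    have "\<bar>2 * \<rho> * mills (2 * \<rho> + x)\<bar> \<le> 2 * \<rho> * (1 / (2 * \<rho>))"
      unfolding abs_mult using False rho abs_mills_shift_le[of "2 * \<rho>" x]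
      by (intro mult_mono) auto
    then have m: "\<bar>2 * \<rho> * mills (2 * \<rho> + x)\<bar> \<le> 1" using rho by simp
    have 3: "\<bar>(K * exp (- \<rho> * x)) * (2 * \<rho> * mills (2 * \<rho> + x))\<bar> \<le> \<bar>K\<bar> * 1"
      unfolding abs_mult[of "K * _"] using abs_exp_nonpos_le[OF rho, of "- x" K] False m
      by (intro mult_mono) auto
    have 4: "r x = (- x / \<rho> + (1 / \<rho>\<^sup>2) + K * exp (- \<rho> * x)) + 2 - (2 * \<rho> + 2 / \<rho>) * mills (\<rho> + x)
        - (K * exp (- \<rho> * x)) * (2 * \<rho> * mills (2 * \<rho> + x))"
      unfolding r_def right_diff_distrib by simp
    have "\<bar>a + 2 - b - c\<bar> \<le> A + (2 + B + k) * 1" if "\<bar>a\<bar> \<le> A" "\<bar>b\<bar> \<le> B" "\<bar>c\<bar> \<le> k * 1"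
      for a b c A B k :: real
      using that by (auto simp: abs_le_iff)
    from this[OF 1 2 3] have "\<bar>r x\<bar> \<le> (1 / \<rho> + 1 / \<rho>\<^sup>2 + \<bar>K\<bar>) * (1 + \<bar>x\<bar>) + (2 + (2 * \<rho> + 2 / \<rho>) * (1 / \<rho>) + \<bar>K\<bar>) * 1"
      unfolding 4 .
    also have "\<dots> \<le> (1 / \<rho> + 1 / \<rho>\<^sup>2 + \<bar>K\<bar>) * (1 + \<bar>x\<bar>) + (2 + (2 * \<rho> + 2 / \<rho>) * (1 / \<rho>) + \<bar>K\<bar>) * (1 + \<bar>x\<bar>)"
      using rho by (intro add_left_mono mult_left_mono) auto
    also have "\<dots> = C * (1 + \<bar>x\<bar>)" unfolding C_def by (rule distrib_right[symmetric])
    finally show ?thesis using False by (simp add: g_def)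
  qed
  have corr: "(LBINT t:{0..}. exp (- \<rho> * t) * (\<integral>\<omega>. R 0 \<omega> * R t \<omega> \<partial>M)) = (\<integral>\<omega>. R 0 \<omega> * g (R 0 \<omega>) \<partial>M)"
  proof (rule resolvent_correlation[where J=J and C=C, OF _ rho gd _ g_le])
    have "gen_B = (\<lambda>f x. deriv f x + max x 0 * (J f x - f x))"
      by (simp add: fun_eq_iff gen_B_def J_def)
    then show "has_extended_generator M R (\<lambda>f x. deriv f x + max x 0 * (J f x - f x))"
      using B unfolding stationary_pdmp_def by simp
    show "continuous_on UNIV (J g)"
      unfolding J_def[abs_def] by (rule continuous_on_compose2[OF gc]) (auto intro: continuous_intros)
    show "\<bar>J (damp e g) x\<bar> \<le> C * (1 + \<bar>x\<bar>)" if "0 < e" for e x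
      using abs_damp_le[of e g "- x"] g_le[of "- x"] that unfolding J_def by simp
    show "(\<lambda>n. J (damp (e n) g) x) \<longlonglongrightarrow> J g x" if "e \<longlonglongrightarrow> 0" for e x
      unfolding J_def by (rule damp_tendsto[OF that])
  qed
  define P where "P = - 1 / \<rho> * s + (2 + 1 / \<rho>\<^sup>2) + K * (1 - W)
      - (2 * \<rho> + 2 / \<rho>) * (mills \<rho> / \<rho>\<^sup>2 + 1 / \<rho> - s / \<rho>\<^sup>2)
      - (2 * \<rho> * K) * ((1 - W) / \<rho> - mills \<rho> / \<rho>\<^sup>2 + mills (2 * \<rho>) / \<rho>\<^sup>2)"
  define N where "N = - 1 / \<rho> * s + 1 / \<rho>\<^sup>2 + K * (1 - W)"
  have neg: "(\<lambda>x. indicator {0..} x * (x * (- 1 / \<rho> * x + 1 / \<rho>\<^sup>2 + K * exp (- \<rho> * x)) * exp (- x\<^sup>2 / 2))) =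
      (\<lambda>x. indicator {0..} x * (x * g (- x) * exp (- x\<^sup>2 / 2)))"
    by (auto simp: fun_eq_iff g_def flow_branch_def split: split_indicator)
  have hn: "has_bochner_integral lborel (\<lambda>x. indicator {0..} x * (x * g (- x) * exp (- x\<^sup>2 / 2))) N"
    using affine_exp_half_integral[OF rho, of "- 1 / \<rho>" "1 / \<rho>\<^sup>2" K]
    unfolding neg N_def s_def W_def .
  have "has_bochner_integral lborel
     (\<lambda>x. indicator {0..} x * (x * (- 1 / \<rho> * x + (2 + 1 / \<rho>\<^sup>2) + K * exp (- \<rho> * x)) * exp (- x\<^sup>2 / 2))
      - (2 * \<rho> + 2 / \<rho>) * (indicator {0..} x * (x * mills (\<rho> + x) * exp (- x\<^sup>2 / 2)))
      - (2 * \<rho> * K) * (indicator {0..} x * (x * exp (- \<rho> * x) * mills (2 * \<rho> + x) * exp (- x\<^sup>2 / 2)))) P"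
    unfolding P_def s_def W_def
    by (intro has_bochner_integral_diff has_bochner_integral_mult_right affine_exp_half_integral
        has_bochner_integral_mills_gauss_mean has_bochner_integral_exp_mills_gauss_mean rho)
  also have "(\<lambda>x. indicator {0..} x * (x * (- 1 / \<rho> * x + (2 + 1 / \<rho>\<^sup>2) + K * exp (- \<rho> * x)) * exp (- x\<^sup>2 / 2))
      - (2 * \<rho> + 2 / \<rho>) * (indicator {0..} x * (x * mills (\<rho> + x) * exp (- x\<^sup>2 / 2)))
      - (2 * \<rho> * K) * (indicator {0..} x * (x * exp (- \<rho> * x) * mills (2 * \<rho> + x) * exp (- x\<^sup>2 / 2)))) =
      (\<lambda>x. indicator {0..} x * (x * g x * exp (- x\<^sup>2 / 2)))"
    by (auto simp: fun_eq_iff g_def r_def algebra_simps split: split_indicator)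
  finally have hp: "has_bochner_integral lborel (\<lambda>x. indicator {0..} x * (x * g x * exp (- x\<^sup>2 / 2))) P" .
  have "sigma_sq M R \<rho> = 8 * ((P - N) / sqrt (2 * pi))"
    unfolding sigma_sq_def corr expectation_X0_mult[OF \<open>g \<in> borel_measurable borel\<close> hp hn] ..
  also have "\<dots> = 4 / s * (P - N)"
    unfolding sqrt_pi_constants s_def[symmetric] using s by (simp add: field_simps)
  \<comment> \<open>The flow-branch terms common to both halves cancel. The coefficient of
    \<open>K\<close> reproduces \<open>D\<close>, and since \<open>K\<close> is a multiple of
    \<open>D\<close>, its square appears.\<close>
  also have "P - N = 2 - (2 * \<rho> + 2 / \<rho>) * (W / \<rho> ^ 3 + 1 / \<rho> - s / \<rho>\<^sup>2) - 2 * K * (- D / \<rho>\<^sup>2 + O2 / (2 * \<rho>\<^sup>2))"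
    unfolding P_def N_def mO mO2 D_def using rho
    by (simp add: field_simps power2_eq_square power3_eq_cube)
  also have "2 * K * (- D / \<rho>\<^sup>2 + O2 / (2 * \<rho>\<^sup>2)) = 4 * D\<^sup>2 / (\<rho> ^ 4 * O2) - 2 * D / \<rho> ^ 4"
    unfolding K_def using rho O2 by (simp add: field_simps power2_eq_square power4_eq_xxxx)
  also have "4 / s * (2 - (2 * \<rho> + 2 / \<rho>) * (W / \<rho> ^ 3 + 1 / \<rho> - s / \<rho>\<^sup>2) - (4 * D\<^sup>2 / (\<rho> ^ 4 * O2) - 2 * D / \<rho> ^ 4)) =
      8 / \<rho> ^ 4 * (\<rho> ^ 3 - \<rho>\<^sup>2 * (2 / s) + \<rho> - (2 / s) * D\<^sup>2 / O2)"
  proof -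
    \<comment> \<open>The term linear in \<open>D\<close> removes every \<open>W\<close> outside the
      square.\<close>
    have "2 - (2 * \<rho> + 2 / \<rho>) * (W / \<rho> ^ 3 + 1 / \<rho> - s / \<rho>\<^sup>2) + 2 * D / \<rho> ^ 4 =
        2 / \<rho> ^ 4 * (s * \<rho> ^ 3 - 2 * \<rho>\<^sup>2 + s * \<rho>)"
      unfolding D_def using rho
      by (simp add: field_simps power2_eq_square power3_eq_cube power4_eq_xxxx)
    then have "4 / s * (2 - (2 * \<rho> + 2 / \<rho>) * (W / \<rho> ^ 3 + 1 / \<rho> - s / \<rho>\<^sup>2) - (4 * D\<^sup>2 / (\<rho> ^ 4 * O2) - 2 * D / \<rho> ^ 4)) =
       4 / s * (2 / \<rho> ^ 4 * (s * \<rho> ^ 3 - 2 * \<rho>\<^sup>2 + s * \<rho>) - 4 * D\<^sup>2 / (\<rho> ^ 4 * O2))"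
      by (simp only: diff_diff_eq2)
    also have "\<dots> = 8 / \<rho> ^ 4 * (\<rho> ^ 3 - \<rho>\<^sup>2 * (2 / s) + \<rho> - (2 / s) * D\<^sup>2 / O2)"
      using rho s O2 by (simp add: field_simps)
    finally show ?thesis .
  qed
  finally show ?thesis unfolding sqrt_pi_constants s_def W_def O2_def D_def .
qed

theorem theorem4p1:
  fixes M\<^sub>F :: "'a measure" and R\<^sub>F :: "real \<Rightarrow> 'a \<Rightarrow> real"
    and M\<^sub>B :: "'b measure" and R\<^sub>B :: "real \<Rightarrow> 'b \<Rightarrow> real"
    and \<rho> :: real
  assumes F: "stationary_pdmp gen_F M\<^sub>F R\<^sub>F"
    and B: "stationary_pdmp gen_B M\<^sub>B R\<^sub>B"
    and rho: "\<rho> > 0"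
  shows "sigma_sq M\<^sub>F R\<^sub>F \<rho> =
           sqrt (32 / pi) *
             (1 - (\<rho>\<^sup>2 - \<rho> * sqrt (pi / 2) + Omega \<rho>)\<^sup>2 /
                  (\<rho> ^ 4 * Omega \<rho> * (2 - Omega \<rho>))) \<and>
         sigma_sq M\<^sub>B R\<^sub>B \<rho> =
           8 / \<rho> ^ 4 *
             (\<rho> ^ 3 - \<rho>\<^sup>2 * sqrt (8 / pi) + \<rho> -
              sqrt (8 / pi) * ((1 + \<rho>\<^sup>2) * Omega \<rho> - \<rho>\<^sup>2)\<^sup>2 / Omega (2 * \<rho>))"
  using sigma_sq_F[OF F rho] sigma_sq_B[OF B rho] by (rule conjI)

end
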